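(* Let $m\ge0$, $n\ge1$, $k\ge0$ be integers. Then $$T_{m,n}^{(-2n-k-1/2)}\left(\tfrac12z^2\right)=2^{-n(m+1)}\,c_{m,n}\,z^{-k(k+1)/2}\,H_{\boldsymbol\Lambda_{k,m,n}}(z),$$ where the partition $\boldsymbol\Lambda_{k,m,n}$ is $$\boldsymbol\Lambda_{k,m,n}=\begin{cases}\left(\{2m-j-k+1\}_{j=0}^{n-1},\{n+k-j\}_{j=0}^{n+k-1}\right),& k<m-n+2,\\[3pt] \left(\{2m-j-k+1\}_{j=0}^{m-k},\{m+1\}_{j=1}^{2(n-m+k-1)},\{m+1-j\}_{j=0}^{m}\right),& m-n+2\le k<m+1,\\[3pt] \left(\{k-j\}_{j=0}^{k-m-1},\{m+1\}_{j=0}^{2n-2},\{m+1-j\}_{j=0}^{m}\right),& k\ge m+1.\end{cases}$$ Equivalently, $$T_{m,n}^{(-2n-k-1/2)}\left(\tfrac12z^2\right)=b_{k,m,n}\,z^{-k(k+1)/2}\,\mathrm{Wr}\left(\{\mathrm{He}_{1+2j}\}_{j=0}^{n+k-1},\{\mathrm{He}_{2(m+1+j)}\}_{j=0}^{n-1}\right),$$ where $$b_{k,m,n}=\frac{2^{-n(m+1)}c_{m,n}}{\Delta\left(\{1+2j\}_{j=0}^{n+k-1},\{2(m+1+j)\}_{j=0}^{n-1}\right)} .$$ Moreover $$T_{m,n}^{(-2n-k-1/2)}\left(-\tfrac12z^2\right)=(-1)^{n(m+1)}2^{-n(m+1)}\,c_{m,n}\,z^{-k(k+1)/2}\,H_{\boldsymbol\Lambda^*_{k,m,n}}(z),$$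 where $\boldsymbol\Lambda^*_{k,m,n}$ is the conjugate partition of $\boldsymbol\Lambda_{k,m,n}$.
   Context: $L_n^{(\alpha)}(z)=\sum_{i=0}^n \frac{(-1)^i}{i!\,(n-i)!}\Big(\prod_{l=i+1}^{n}(\alpha+l)\Big)z^i$ is the associated Laguerre polynomial; $T_{m,n}^{(\mu)}(z)=\det\left[\frac{d^{j+k}}{dz^{j+k}}L_{m+n}^{(\mu+1)}(z)\right]_{j,k=0}^{n-1}$ for $m\ge0$, $n\ge1$. $c_{m,n}=(-1)^{n(2m+1+n)/2}\prod_{j=1}^n\frac{(j-1)!}{(m+j)!}$. $\mathrm{He}_n(z)$ is the (monic) probabilists' Hermite polynomial. $\mathrm{Wr}(f_1,\dots,f_r)=\det[f_k^{(j-1)}]_{j,k=1}^r$ (derivatives in $z$). For a sequence $\boldsymbol h=(h_1,\dots,h_r)$, $\Delta(\boldsymbol h)=\prod_{1\le j<k\le r}(h_k-h_j)$. For a partition $\boldsymbol\lambda=(\lambda_1\ge\dots\ge\lambda_r)$ with positive parts, the degree vector is $\boldsymbol h_{\boldsymbol\lambda}=(h_1>\dots>h_r)$ with $h_j=\lambda_j+r-j$, and the Wronskian Hermite polynomial is $H_{\boldsymbol\lambda}(z)=\mathrm{Wr}(\mathrm{He}_{h_1}(z),\dots,\mathrm{He}_{h_r}(z))/\Delta(\boldsymbol h_{\boldsymbol\lambda})$. Notation $\{a_j\}_{j=p}^{q}$ denotes the list $a_p,a_{p+1},\dots,a_q$ (empty if $q<p$); lists separated by commas are concatenated. *)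

theory Defs
  imports Complex_Main "Jordan_Normal_Form.Determinant"
begin

definition laguerre :: "nat \<Rightarrow> complex \<Rightarrow> complex poly" where
  "laguerre n \<alpha> =
     (\<Sum>i\<le>n. monom ((-1) ^ i / (fact i * fact (n - i)) * (\<Prod>l = i + 1..n. \<alpha> + of_nat l)) i)"

definition T_poly :: "nat \<Rightarrow> nat \<Rightarrow> complex \<Rightarrow> complex poly" where
  "T_poly m n \<mu> = det (mat n n (\<lambda>(j, k). (pderiv ^^ (j + k)) (laguerre (m + n) (\<mu> + 1))))"

(* n * (2 * m + 1 + n) is always even, so the division in the exponent is exact *)
definition c_const :: "nat \<Rightarrow> nat \<Rightarrow> complex" where
  "c_const m n =
     (-1) ^ (n * (2 * m + 1 + n) div 2) * (\<Prod>j = 1..n. fact (j - 1) / fact (m + j))"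

fun hermite :: "nat \<Rightarrow> complex poly" where
  "hermite 0 = 1"
| "hermite (Suc 0) = [:0, 1:]"
| "hermite (Suc (Suc n)) = [:0, 1:] * hermite (Suc n) - smult (of_nat (Suc n)) (hermite n)"

lemma pderiv_hermite_Suc: "pderiv (hermite (Suc n)) = smult (of_nat (Suc n)) (hermite n)"
proof (induction n rule: less_induct)
  case (less n)
  show ?case
  proof (cases n)
    case 0
    then show ?thesis by (simp add: pderiv_pCons)
  next
    case (Suc k)
    have 1: "pderiv (hermite (Suc k)) = smult (of_nat (Suc k)) (hermite k)"
      using less Suc by simp
    have 2: "smult (of_nat (Suc k)) (pderiv (hermite k))
               = smult (of_nat (Suc k)) ([:0, 1:] * hermite k - hermite (Suc k))"
    proof (cases k)
      case 0
      then show ?thesis by simp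
    next
      case (Suc l)
      then have "pderiv (hermite k) = smult (of_nat (Suc l)) (hermite l)"
        using less \<open>n = Suc k\<close> by simp
      then show ?thesis using Suc by simp
    qed
    have "pderiv (hermite (Suc n)) = hermite (Suc k) + [:0, 1:] * pderiv (hermite (Suc k))
            - smult (of_nat (Suc k)) (pderiv (hermite k))"
      unfolding Suc
      by (simp add: pderiv_diff pderiv_mult pderiv_smult pderiv_pCons del: of_nat_Suc)
    also have "\<dots> = hermite (Suc k) + smult (of_nat (Suc k)) (hermite (Suc k))"
      unfolding 1 2 by (simp add: smult_diff_right del: of_nat_Suc)
    also have "\<dots> = smult (of_nat (Suc n)) (hermite n)"
      unfolding Suc of_nat_Suc[of "Suc k"] by (simp only: smult_add_left smult_1_left)
    finally show ?thesis .
  qed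
qed

lemma hermite_Suc: "hermite (Suc n) = [:0, 1:] * hermite n - pderiv (hermite n)"
  by (cases n) (simp_all add: pderiv_hermite_Suc del: of_nat_Suc)

(* Differential form of the Rodrigues formula
   He_n(z) = (-1)^n exp(z^2/2) (d/dz)^n exp(-z^2/2) *)
lemma hermite_rodrigues:
  "((\<lambda>z. (-1) ^ n * poly (hermite n) z * exp (- z\<^sup>2 / 2)) has_field_derivative
     (-1) ^ Suc n * poly (hermite (Suc n)) z * exp (- z\<^sup>2 / 2)) (at z)"
  unfolding hermite_Suc
  by (auto intro!: derivative_eq_intros poly_DERIV simp: algebra_simps)

definition wronskian :: "complex poly list \<Rightarrow> complex poly" where
  "wronskian fs = det (mat (length fs) (length fs) (\<lambda>(j, k). (pderiv ^^ j) (fs ! k)))"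

definition vandermonde :: "nat list \<Rightarrow> complex" where
  "vandermonde hs = (\<Prod>k<length hs. \<Prod>j<k. of_nat (hs ! k) - of_nat (hs ! j))"

definition is_partition :: "nat list \<Rightarrow> bool" where
  "is_partition ps \<longleftrightarrow> sorted_wrt (\<ge>) ps \<and> (\<forall>p\<in>set ps. 0 < p)"

(* h_j = lambda_j + r - j for j = 1, ..., r, with list positions counted from 0 *)
definition degree_vector :: "nat list \<Rightarrow> nat list" where
  "degree_vector ps = map (\<lambda>j. ps ! j + (length ps - (j + 1))) [0..<length ps]"

definition wronskian_hermite :: "nat list \<Rightarrow> complex poly" where
  "wronskian_hermite ps =
     smult (1 / vandermonde (degree_vector ps)) (wronskian (map hermite (degree_vector ps)))"

(* The j-th part of the conjugate, 1 \<le> j \<le> hd ps, is the number of parts of ps that are \<ge> j. *)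
definition conjugate_partition :: "nat list \<Rightarrow> nat list" where
  "conjugate_partition ps =
     (if ps = [] then [] else map (\<lambda>j. length (filter (\<lambda>p. j \<le> p) ps)) [1..<hd ps + 1])"

(* For n \<ge> 1 the inequalities on k, m, n make every natural number subtraction exact. *)
definition Lambda :: "nat \<Rightarrow> nat \<Rightarrow> nat \<Rightarrow> nat list" where
  "Lambda k m n =
    (if int k < int m - int n + 2 then
       map (\<lambda>j. 2 * m + 1 - j - k) [0..<n] @ map (\<lambda>j. n + k - j) [0..<n + k]
     else if k < m + 1 then
       map (\<lambda>j. 2 * m + 1 - j - k) [0..<m - k + 1]
         @ replicate (2 * (n + k - m - 1)) (m + 1) @ map (\<lambda>j. m + 1 - j) [0..<m + 1]
     else
       map (\<lambda>j. k - j) [0..<k - m]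
         @ replicate (2 * n - 1) (m + 1) @ map (\<lambda>j. m + 1 - j) [0..<m + 1])"

lemma is_partition_Lambda: "is_partition (Lambda k m n)"
proof -
  have up: "sorted_wrt (\<ge>) (map f [0..<N])"
    if "\<And>i j. i < j \<Longrightarrow> f j \<le> f i" for f :: "nat \<Rightarrow> nat" and N
    using that by (simp add: sorted_wrt_iff_nth_less)
  have rep: "sorted_wrt (\<ge>) (replicate N c)" for c :: nat and N
    by (simp add: sorted_wrt_iff_nth_less)
  show ?thesis
    unfolding is_partition_def Lambda_def
    by (auto simp: sorted_wrt_append rep simp del: upt_Suc intro!: up)
qed

definition b_const :: "nat \<Rightarrow> nat \<Rightarrow> nat \<Rightarrow> complex" where
  "b_const k m n =
     2 powi (- int (n * (m + 1))) * c_const m n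
       / vandermonde (map (\<lambda>j. 1 + 2 * j) [0..<n + k] @ map (\<lambda>j. 2 * (m + 1 + j)) [0..<n])"

end

theory Submission
  imports Defs "HOL-Computational_Algebra.Formal_Power_Series"
begin

text \<open>
  Written with the Euler operator \<open>\<theta> = z D\<close>, a Wronskian of length \<open>r\<close> is, up to a power of \<open>z\<close>, the
  determinant with entries \<open>q\<^sub>i(\<theta>) f\<^sub>k\<close> for any monic polynomials \<open>q\<^sub>i\<close> of degree \<open>i < r\<close>. For the
  Hermite polynomials of degrees \<open>1, 3, \<dots>, 2 (n + k) - 1\<close> and \<open>2 m + 2, \<dots>, 2 m + 2 n\<close> the choice
  \<open>q\<^sub>i = (\<theta> - 1) (\<theta> - 3) \<dots> (\<theta> - 2 i + 1)\<close> makes the matrix block triangular; the remaining block is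
  the Wronskian in \<open>z\<^sup>2 / 2\<close> of consecutive Laguerre polynomials with a common parameter, and this
  equals \<open>T\<close> by the contiguity relation in the parameter. The listed degrees are those of \<open>\<Lambda>\<close>.

  For the conjugate partition, the Wronskian Hermite polynomial is a quotient of minors of the
  Toeplitz matrices of \<open>exp (z t - t\<^sup>2 / 2)\<close> and \<open>exp t\<close>. Passing to the inverse matrix replaces
  \<open>z\<close> by \<open>\<i> z\<close> up to scaling, and a minor by its complementary minor, which belongs to the
  conjugate partition. Since only quotients occur, no sign needs to be computed.
\<close>

section \<open>Determinants\<close>

lemma det_mat_mult:
  fixes f g :: "nat \<Rightarrow> nat \<Rightarrow> 'a :: comm_ring_1"
  shows "det (mat n n (\<lambda>(i, j). \<Sum>l<n. f i l * g l j))
    = det (mat n n (\<lambda>(i, j). f i j)) * det (mat n n (\<lambda>(i, j). g i j))"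
proof -
  have "mat n n (\<lambda>(i, j). \<Sum>l<n. f i l * g l j) = mat n n (\<lambda>(i, j). f i j) * mat n n (\<lambda>(i, j). g i j)"
    by (rule eq_matI) (auto simp: scalar_prod_def lessThan_atLeast0)
  then show ?thesis by (simp add: det_mult[of _ n])
qed

lemma det_mat_upper_triangular:
  fixes f :: "nat \<Rightarrow> nat \<Rightarrow> 'a :: idom"
  assumes "\<And>i j. j < i \<Longrightarrow> i < n \<Longrightarrow> f i j = 0"
  shows "det (mat n n (\<lambda>(i, j). f i j)) = (\<Prod>i<n. f i i)"
proof -
  have "det (mat n n (\<lambda>(i, j). f i j)) = prod_list (diag_mat (mat n n (\<lambda>(i, j). f i j)))"
    by (rule det_upper_triangular) (use assms in \<open>auto simp: upper_triangular_def\<close>)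
  then show ?thesis by (simp add: prod_list_diag_prod lessThan_atLeast0)
qed

lemma det_mat_transpose:
  fixes f :: "nat \<Rightarrow> nat \<Rightarrow> 'a :: comm_ring_1"
  shows "det (mat n n (\<lambda>(i, j). f j i)) = det (mat n n (\<lambda>(i, j). f i j))"
proof -
  have "transpose_mat (mat n n (\<lambda>(i, j). f i j)) = mat n n (\<lambda>(i, j). f j i)"
    by (rule eq_matI) auto
  then show ?thesis using det_transpose[of "mat n n (\<lambda>(i, j). f i j)" n] by simp
qed

lemma det_mat_lower_triangular:
  fixes f :: "nat \<Rightarrow> nat \<Rightarrow> 'a :: idom"
  assumes "\<And>i j. i < j \<Longrightarrow> j < n \<Longrightarrow> f i j = 0"
  shows "det (mat n n (\<lambda>(i, j). f i j)) = (\<Prod>i<n. f i i)"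
  using det_mat_upper_triangular[of n "\<lambda>i j. f j i"] assms det_mat_transpose[of n f] by simp

lemma det_mat_scale:
  fixes f :: "nat \<Rightarrow> nat \<Rightarrow> 'a :: idom"
  shows "det (mat n n (\<lambda>(i, j). r i * f i j * c j))
    = (\<Prod>i<n. r i) * (\<Prod>j<n. c j) * det (mat n n (\<lambda>(i, j). f i j))"
proof -
  have diag: "det (mat n n (\<lambda>(i, j). if i = j then d j else 0)) = (\<Prod>i<n. d i)" for d :: "nat \<Rightarrow> 'a"
    by (subst det_mat_upper_triangular) auto
  have "det (mat n n (\<lambda>(i, j). r i * f i j * c j))
     = det (mat n n (\<lambda>(i, j). \<Sum>l<n. (r i * f i l) * (if l = j then c j else 0)))"
    by (intro arg_cong[where f = det] eq_matI) (auto simp: sum.delta if_distrib cong: if_cong)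
  also have "\<dots> = det (mat n n (\<lambda>(i, j). r i * f i j)) * (\<Prod>j<n. c j)"
    by (simp only: det_mat_mult diag)
  also have "det (mat n n (\<lambda>(i, j). r i * f i j))
     = det (mat n n (\<lambda>(i, j). \<Sum>l<n. (if i = l then r l else 0) * f l j))"
    by (intro arg_cong[where f = det] eq_matI)
      (auto simp: if_distrib[of "\<lambda>x. x * _"] cong: if_cong)
  also have "\<dots> = (\<Prod>i<n. r i) * det (mat n n (\<lambda>(i, j). f i j))"
    by (simp only: det_mat_mult diag)
  finally show ?thesis by (simp add: mult_ac)
qed

lemma det_mat_block_upper:
  fixes f :: "nat \<Rightarrow> nat \<Rightarrow> 'a :: idom"
  assumes "\<And>i j. r \<le> i \<Longrightarrow> i < r + n \<Longrightarrow> j < r \<Longrightarrow> f i j = 0"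
  shows "det (mat (r + n) (r + n) (\<lambda>(i, j). f i j))
    = det (mat r r (\<lambda>(i, j). f i j)) * det (mat n n (\<lambda>(i, j). f (r + i) (r + j)))"
proof -
  have "mat (r + n) (r + n) (\<lambda>(i, j). f i j) = four_block_mat (mat r r (\<lambda>(i, j). f i j))
      (mat r n (\<lambda>(i, j). f i (r + j))) (0\<^sub>m n r) (mat n n (\<lambda>(i, j). f (r + i) (r + j)))"
    by (rule eq_matI) (use assms in auto)
  then show ?thesis
    by (simp only: det_four_block_mat_lower_left_zero[OF mat_carrier mat_carrier refl mat_carrier])
qed

lemma det_mat_block_lower:
  fixes f :: "nat \<Rightarrow> nat \<Rightarrow> 'a :: idom"
  assumes "\<And>i j. i < r \<Longrightarrow> r \<le> j \<Longrightarrow> j < r + n \<Longrightarrow> f i j = 0"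
  shows "det (mat (r + n) (r + n) (\<lambda>(i, j). f i j))
    = det (mat r r (\<lambda>(i, j). f i j)) * det (mat n n (\<lambda>(i, j). f (r + i) (r + j)))"
proof -
  have "det (mat (r + n) (r + n) (\<lambda>(i, j). f i j)) = det (mat (r + n) (r + n) (\<lambda>(i, j). f j i))"
    by (rule det_mat_transpose[symmetric])
  also have "\<dots> = det (mat r r (\<lambda>(i, j). f j i)) * det (mat n n (\<lambda>(i, j). f (r + j) (r + i)))"
    by (rule det_mat_block_upper) (use assms in auto)
  finally show ?thesis by (simp only: det_mat_transpose[of _ "\<lambda>i j. f i j"]
        det_mat_transpose[of _ "\<lambda>i j. f (r + i) (r + j)"])
qed

lemma poly_det_mat:
  fixes f :: "nat \<Rightarrow> nat \<Rightarrow> 'a :: comm_ring_1 poly"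
  shows "poly (det (mat n n (\<lambda>(i, j). f i j))) z = det (mat n n (\<lambda>(i, j). poly (f i j) z))"
proof -
  interpret comm_ring_hom "\<lambda>p. poly p z" by unfold_locales auto
  show ?thesis
    unfolding hom_det[symmetric] by (intro arg_cong[where f = det] eq_matI) auto
qed

section \<open>Monic families and the Vandermonde determinant\<close>

definition monic_family :: "nat \<Rightarrow> (nat \<Rightarrow> 'a :: comm_ring_1 poly) \<Rightarrow> bool" where
  "monic_family n q \<longleftrightarrow> (\<forall>i<n. degree (q i) = i \<and> coeff (q i) i = 1)"

lemma monic_family_prod_roots:
  fixes x :: "nat \<Rightarrow> 'a :: idom"
  shows "monic_family n (\<lambda>i. \<Prod>t<i. [:- x t, 1:])"
proof -
  have "degree (\<Prod>t<i. [:- x t, 1:]) = i" for i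
    by (simp add: degree_prod_eq_sum_degree)
  moreover have "lead_coeff (\<Prod>t<i. [:- x t, 1:]) = 1" for i
    by (simp only: lead_coeff_prod) simp
  ultimately show ?thesis unfolding monic_family_def by metis
qed

text \<open>Two monic families of increasing degree differ by a unitriangular change of basis.\<close>
lemma det_monic_family:
  fixes w :: "nat \<Rightarrow> 'b \<Rightarrow> 'a :: idom" and x :: "'b \<Rightarrow> 'a"
  assumes "monic_family n q" "monic_family n q'"
  shows "det (mat n n (\<lambda>(i, k). \<Sum>p\<in>P. w k p * poly (q i) (x p)))
    = det (mat n n (\<lambda>(i, k). \<Sum>p\<in>P. w k p * poly (q' i) (x p)))"
proof -
  have "det (mat n n (\<lambda>(i, k). \<Sum>p\<in>P. w k p * poly (q i) (x p)))
    = det (mat n n (\<lambda>(i, k). \<Sum>p\<in>P. w k p * x p ^ i))" if q: "monic_family n q" for q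
  proof -
    have "poly (q i) y = (\<Sum>l<n. coeff (q i) l * y ^ l)" if "i < n" for i y
    proof -
      have d: "degree (q i) = i" using q that by (simp add: monic_family_def)
      show ?thesis unfolding poly_altdef d using that
        by (intro sum.mono_neutral_left) (auto simp: d coeff_eq_0)
    qed
    then have "det (mat n n (\<lambda>(i, k). \<Sum>p\<in>P. w k p * poly (q i) (x p)))
       = det (mat n n (\<lambda>(i, k). \<Sum>l<n. coeff (q i) l * (\<Sum>p\<in>P. w k p * x p ^ l)))"
      by (intro arg_cong[where f = det] eq_matI)
        (auto simp: sum_distrib_left mult_ac intro: sum.swap)
    also have "\<dots> = det (mat n n (\<lambda>(i, l). coeff (q i) l))
        * det (mat n n (\<lambda>(i, k). \<Sum>p\<in>P. w k p * x p ^ i))"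
      by (rule det_mat_mult)
    also have "det (mat n n (\<lambda>(i, l). coeff (q i) l)) = (\<Prod>i<n. coeff (q i) i)"
      by (rule det_mat_lower_triangular) (use q in \<open>auto simp: monic_family_def coeff_eq_0\<close>)
    also have "\<dots> = 1" using q by (intro prod.neutral) (auto simp: monic_family_def)
    finally show ?thesis by simp
  qed
  then show ?thesis using assms by simp
qed

text \<open>In the Newton basis with nodes at the entries of \<open>hs\<close> the evaluation matrix
  is upper triangular with the Vandermonde factors on its diagonal; \<open>det_monic_family\<close>
  transfers this to any other monic family.\<close>

lemma vandermonde_eq_det:
  assumes "monic_family (length hs) q"
  shows "vandermonde hs = det (mat (length hs) (length hs) (\<lambda>(i, k). poly (q i) (of_nat (hs ! k))))"
proof -
  let ?n = "length hs" and ?r = "\<lambda>i. \<Prod>t<i. [:- of_nat (hs ! t), 1 :: complex:]"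
  \<comment> \<open>Kronecker delta weights bring the entries into the weighted form that
    \<open>det_monic_family\<close> expects.\<close>
  have "det (mat ?n ?n (\<lambda>(i, k). poly (q i) (of_nat (hs ! k))))
    = det (mat ?n ?n (\<lambda>(i, k). \<Sum>p<?n. (if p = k then 1 else 0) * poly (q i) (of_nat (hs ! p))))"
    by (intro arg_cong[where f = det] eq_matI) (auto simp: sum.delta' if_distrib[of "\<lambda>x. x * _"] cong: if_cong)
  also have "\<dots> = det (mat ?n ?n (\<lambda>(i, k). \<Sum>p<?n. (if p = k then 1 else 0) * poly (?r i) (of_nat (hs ! p))))"
    by (rule det_monic_family[OF assms monic_family_prod_roots])
  also have "\<dots> = det (mat ?n ?n (\<lambda>(i, k). poly (?r i) (of_nat (hs ! k))))"
    by (intro arg_cong[where f = det] eq_matI) (auto simp: sum.delta' if_distrib[of "\<lambda>x. x * _"] cong: if_cong)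
  also have "\<dots> = (\<Prod>i<?n. poly (?r i) (of_nat (hs ! i)))"
    by (rule det_mat_upper_triangular) (auto simp: poly_prod prod_zero_iff)
  finally show ?thesis by (simp add: vandermonde_def poly_prod)
qed

section \<open>Complementary minors and conjugation\<close>

text \<open>A minor of the infinite upper triangular Toeplitz matrix of \<open>a\<close>, with the
  columns \<open>hs\<close> in the listed order. The guard gives zero below the diagonal, where the
  natural subtraction would truncate.\<close>

definition toeplitz :: "(nat \<Rightarrow> complex) \<Rightarrow> nat list \<Rightarrow> complex mat" where
  "toeplitz a hs = mat (length hs) (length hs) (\<lambda>(i, k). if i \<le> hs ! k then a (hs ! k - i) else 0)"

text \<open>Equivalently, the generating functions of \<open>a\<close> and \<open>b\<close> have
  product 1, so their triangular Toeplitz matrices are inverse to each other.\<close>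

definition conv_inverse :: "(nat \<Rightarrow> 'a :: comm_ring_1) \<Rightarrow> (nat \<Rightarrow> 'a) \<Rightarrow> bool" where
  "conv_inverse a b \<longleftrightarrow> (\<forall>j. (\<Sum>l\<le>j. a l * b (j - l)) = (if j = 0 then 1 else 0))"

text \<open>The transpose times the matrix is the identity, so the square of the determinant is
  1.\<close>

lemma det_permutation_nonzero:
  fixes c :: "nat list"
  assumes "distinct c" "set c = {..<n}"
  shows "det (mat n n (\<lambda>(i, k). if c ! k = i then 1 else 0 :: complex)) \<noteq> 0"
proof -
  let ?f = "\<lambda>i k. if c ! k = i then 1 else 0 :: complex"
  have len: "length c = n" using distinct_card[OF assms(1)] assms(2) by simp
  have mem: "c ! k < n" if "k < n" for k using that assms(2) len nth_mem by fastforce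
  have "det (mat n n (\<lambda>(i, j). \<Sum>l<n. ?f l i * ?f l j)) = det (mat n n (\<lambda>(i, j). if i = j then 1 else 0 :: complex))"
    using assms(1) len mem
    by (intro arg_cong[where f = det] eq_matI)
      (auto simp: if_distrib[of "\<lambda>x. x * _"] nth_eq_iff_index_eq cong: if_cong)
  also have "\<dots> = 1" by (subst det_mat_upper_triangular) auto
  finally have "det (mat n n (\<lambda>(i, j). ?f j i)) * det (mat n n (\<lambda>(i, j). ?f i j)) = 1"
    by (simp only: det_mat_mult)
  then show ?thesis by auto
qed

text \<open>Jacobi's complementary minor theorem for a Toeplitz matrix and its inverse; the constant
  is a sign, but only its independence of the sequences matters.\<close>
lemma det_toeplitz_complement:
  assumes c: "distinct (xs @ map (\<lambda>y. N - 1 - y) ys)" "set (xs @ map (\<lambda>y. N - 1 - y) ys) = {..<N}"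
    and ys: "\<And>y. y \<in> set ys \<Longrightarrow> y < N"
  shows "\<exists>\<epsilon>. \<epsilon> \<noteq> 0 \<and>
    (\<forall>a b. a 0 = 1 \<longrightarrow> conv_inverse a b \<longrightarrow> det (toeplitz a xs) = \<epsilon> * det (toeplitz b ys))"
proof -
  define c where "c = xs @ map (\<lambda>y. N - 1 - y) ys"
  define R where "R = length xs"
  define S where "S = length ys"
  have N: "N = R + S" using distinct_card[OF c(1)] c(2) by (simp add: R_def S_def)
  have dc: "distinct c" and sc: "set c = {..<N}" and lc: "length c = N"
    using c N by (auto simp: c_def R_def S_def)
  have c1: "c ! l = xs ! l" if "l < R" for l using that by (simp add: c_def R_def nth_append)
  have c2: "c ! (R + l) = N - 1 - ys ! l" if "l < S" for l
    using that by (simp add: c_def R_def S_def nth_append)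
  have ysN: "ys ! l < N" if "l < S" for l using ys[of "ys ! l"] that by (simp add: S_def)
  let ?P = "det (mat N N (\<lambda>(i, k). if c ! k = i then 1 else 0 :: complex))"
  let ?Q = "det (mat S S (\<lambda>(i, k). if rev [0..<S] ! k = i then 1 else 0 :: complex))"
  have P: "?P \<noteq> 0" by (rule det_permutation_nonzero[OF dc sc])
  have Q: "?Q \<noteq> 0" by (rule det_permutation_nonzero) auto
  have "det (toeplitz a xs) * ?Q = ?P * det (toeplitz b ys)" if a0: "a 0 = 1" and ab: "conv_inverse a b" for a b
  proof -
    \<comment> \<open>\<open>?A\<close> is the Toeplitz matrix of \<open>a\<close> with columns
      ordered by \<open>c\<close>, and \<open>?B\<close> that of \<open>b\<close> with rows ordered
      by \<open>c\<close>. \<open>?X\<close> has unit vectors in front, then the last columns of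
      \<open>?B\<close> in reverse order. Hence \<open>?A\<close> times \<open>?X\<close> is
      \<open>?G\<close>: the \<open>xs\<close> columns of \<open>?A\<close>, followed by reversed
      unit vectors.\<close>
    let ?A = "\<lambda>i l. if i \<le> c ! l then a (c ! l - i) else 0"
    let ?B = "\<lambda>l m. if c ! l \<le> m then b (m - c ! l) else 0"
    let ?X = "\<lambda>l j. if j < R then (if l = j then 1 else 0) else ?B l (N - 1 - (j - R))"
    let ?G = "\<lambda>i j. if j < R then ?A i j else (if i = N - 1 - (j - R) then 1 else 0)"
    have AB: "(\<Sum>l<N. ?A i l * ?B l m) = (if i = m then 1 else 0)" if "m < N" for i m
    proof -
      have "(\<Sum>l<N. ?A i l * ?B l m)
        = (\<Sum>p<N. (if i \<le> p then a (p - i) else 0) * (if p \<le> m then b (m - p) else 0))"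
        using dc sc lc
        by (intro sum.reindex_bij_betw[OF bij_betw_nth]) auto
      also have "\<dots> = (\<Sum>p\<in>{i..m}. a (p - i) * b (m - p))"
        using that by (intro sum.mono_neutral_cong_right) auto
      also have "\<dots> = (if i = m then 1 else 0)"
      proof (cases "i \<le> m")
        case True
        have "(\<Sum>p\<in>{i..m}. a (p - i) * b (m - p)) = (\<Sum>l\<le>m - i. a l * b (m - i - l))"
          using True by (intro sum.reindex_bij_witness[of _ "\<lambda>l. l + i" "\<lambda>p. p - i"]) auto
        also have "\<dots> = (if m - i = 0 then 1 else 0)"
          using ab unfolding conv_inverse_def by blast
        finally show ?thesis using True by auto
      qed auto
      finally show ?thesis .
    qed
    have "det (mat N N (\<lambda>(i, j). ?A i j)) * det (mat N N (\<lambda>(i, j). ?X i j)) = det (mat N N (\<lambda>(i, j). ?G i j))"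
      unfolding det_mat_mult[symmetric]
    proof (intro arg_cong[where f = det] eq_matI)
      fix i j assume ij: "i < dim_row (mat N N (\<lambda>(i, j). ?G i j))" "j < dim_col (mat N N (\<lambda>(i, j). ?G i j))"
      show "mat N N (\<lambda>(i, j). \<Sum>l<N. ?A i l * ?X l j) $$ (i, j) = mat N N (\<lambda>(i, j). ?G i j) $$ (i, j)"
      proof (cases "j < R")
        case True
        then show ?thesis using ij by (simp add: if_distrib[of "\<lambda>x. _ * x"] cong: if_cong)
      next
        case False
        then show ?thesis using ij AB[of "N - 1 - (j - R)" i] by simp
      qed
    qed auto
    also have "det (mat N N (\<lambda>(i, j). ?G i j)) = det (mat R R (\<lambda>(i, j). ?G i j)) * det (mat S S (\<lambda>(i, j). ?G (R + i) (R + j)))"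
      unfolding N by (rule det_mat_block_lower) auto
    also have "mat R R (\<lambda>(i, j). ?G i j) = toeplitz a xs"
      unfolding toeplitz_def by (rule eq_matI) (auto simp: R_def[symmetric] c1)
    also have "mat S S (\<lambda>(i, j). ?G (R + i) (R + j)) = mat S S (\<lambda>(i, k). if rev [0..<S] ! k = i then 1 else 0)"
      by (rule eq_matI) (auto simp: N rev_nth)
    \<comment> \<open>Reordering columns is multiplication by a permutation matrix, and the Toeplitz
      factor is unitriangular since \<open>a 0 = 1\<close>.\<close>
    also have "det (mat N N (\<lambda>(i, j). ?A i j))
       = det (mat N N (\<lambda>(i, l). \<Sum>p<N. (if i \<le> p then a (p - i) else 0) * (if c ! l = p then 1 else 0)))"
      using sc lc nth_mem by (intro arg_cong[where f = det] eq_matI)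
        (fastforce simp: if_distrib[of "\<lambda>x. _ * x"] cong: if_cong)+
    also have "\<dots> = ?P"
      unfolding det_mat_mult by (subst det_mat_upper_triangular) (auto simp: a0)
    also have "det (mat N N (\<lambda>(i, j). ?X i j)) = det (mat R R (\<lambda>(i, j). ?X i j)) * det (mat S S (\<lambda>(i, j). ?X (R + i) (R + j)))"
      unfolding N by (rule det_mat_block_upper) auto
    also have "det (mat R R (\<lambda>(i, j). ?X i j)) = 1"
      by (subst det_mat_upper_triangular) auto
    \<comment> \<open>The entry of the Toeplitz matrix of \<open>b\<close> in row
      \<open>N - 1 - y\<close> and column \<open>N - 1 - j\<close> depends only on
      \<open>y - j\<close>, so the two reflections cancel and leave the transposed minor for
      \<open>ys\<close>.\<close>
    also have "mat S S (\<lambda>(i, j). ?X (R + i) (R + j)) = mat S S (\<lambda>(i, j). (if j \<le> ys ! i then b (ys ! i - j) else 0))"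
    proof (rule eq_matI)
      fix i j assume "i < dim_row (mat S S (\<lambda>(i, j). (if j \<le> ys ! i then b (ys ! i - j) else 0)))"
        "j < dim_col (mat S S (\<lambda>(i, j). (if j \<le> ys ! i then b (ys ! i - j) else 0)))"
      then show "mat S S (\<lambda>(i, j). ?X (R + i) (R + j)) $$ (i, j) = mat S S (\<lambda>(i, j). (if j \<le> ys ! i then b (ys ! i - j) else 0)) $$ (i, j)"
        using ysN[of i] N by (auto simp: c2)
    qed auto
    also have "det \<dots> = det (toeplitz b ys)"
      using det_mat_transpose[of S "\<lambda>i j. if i \<le> ys ! j then b (ys ! j - i) else 0"]
      by (simp add: toeplitz_def S_def)
    finally show ?thesis by simp
  qed
  then have "det (toeplitz a xs) = ?P / ?Q * det (toeplitz b ys)" if "a 0 = 1" "conv_inverse a b" for a b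
    using that Q by (simp add: field_simps)
  then show ?thesis using P Q by (intro exI[of _ "?P / ?Q"]) simp
qed

text \<open>The logarithmic derivatives are opposite, so by the product rule the product of the two
  series is constant.\<close>

lemma conv_inverse_fps:
  fixes a b :: "nat \<Rightarrow> 'a :: field_char_0"
  assumes "fps_deriv (Abs_fps a) = P * Abs_fps a" "fps_deriv (Abs_fps b) = - P * Abs_fps b" "a 0 * b 0 = 1"
  shows "conv_inverse a b"
proof -
  have "fps_deriv (Abs_fps a * Abs_fps b) = 0" using assms by (simp add: algebra_simps)
  then have "Abs_fps a * Abs_fps b = fps_const (fps_nth (Abs_fps a * Abs_fps b) 0)"
    by (simp only: fps_deriv_eq_0_iff)
  also have "\<dots> = fps_const 1" using assms(3) by (simp add: fps_mult_nth_0)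
  finally have "fps_nth (Abs_fps a * Abs_fps b) j = fps_nth (fps_const 1 :: 'a fps) j" for j by simp
  then show ?thesis by (simp add: conv_inverse_def fps_mult_nth atLeast0AtMost fps_const_def)
qed

text \<open>The series is \<open>exp (w x t - w^2 t^2 / 2)\<close>, with logarithmic derivative
  \<open>w x - w^2 t\<close>; coefficientwise this is the three-term recurrence. It is used with
  \<open>w = 1\<close> and \<open>w = \<i>\<close>.\<close>

lemma fps_deriv_hermite:
  "fps_deriv (Abs_fps (\<lambda>j. w ^ j * (poly (hermite j) x / fact j)))
    = (fps_const (w * x) - fps_const (w\<^sup>2) * fps_X) * Abs_fps (\<lambda>j. w ^ j * (poly (hermite j) x / fact j))"
proof (rule fps_ext)
  fix n
  show "fps_nth (fps_deriv (Abs_fps (\<lambda>j. w ^ j * (poly (hermite j) x / fact j)))) n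
    = fps_nth ((fps_const (w * x) - fps_const (w\<^sup>2) * fps_X)
        * Abs_fps (\<lambda>j. w ^ j * (poly (hermite j) x / fact j))) n"
  proof (cases n)
    case (Suc m)
    have "fps_nth (fps_deriv (Abs_fps (\<lambda>j. w ^ j * (poly (hermite j) x / fact j)))) n 
     = w ^ n * w * (poly (hermite (Suc n)) x / fact n)"
      by (simp add: field_simps del: of_nat_Suc hermite.simps)
    also have "\<dots> = w * x * (w ^ n * (poly (hermite n) x / fact n)) - w^2 * (w ^ m * (poly (hermite m) x / fact m))"
      by (simp add: Suc field_simps power2_eq_square del: of_nat_Suc)
    also have "\<dots> = fps_nth ((fps_const (w * x) - fps_const (w\<^sup>2) * fps_X)
        * Abs_fps (\<lambda>j. w ^ j * (poly (hermite j) x / fact j))) n"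
      by (simp add: Suc left_diff_distrib mult.assoc[of "fps_const _" fps_X] del: fact_Suc hermite.simps power_Suc)
    finally show ?thesis .
  qed (simp add: left_diff_distrib mult.assoc[of "fps_const _" fps_X])
qed

text \<open>Passing from \<open>(w, x) = (1, z)\<close> to \<open>(\<i>, \<i> z)\<close> negates the
  exponent \<open>z t - t^2 / 2\<close>.\<close>

lemma conv_inverse_hermite:
  "conv_inverse (\<lambda>j. poly (hermite j) z / fact j) (\<lambda>j. \<i> ^ j * (poly (hermite j) (\<i> * z) / fact j))"
proof (rule conv_inverse_fps)
  show "fps_deriv (Abs_fps (\<lambda>j. poly (hermite j) z / fact j))
    = (fps_const z - fps_X) * Abs_fps (\<lambda>j. poly (hermite j) z / fact j)"
    using fps_deriv_hermite[of 1 z] by simp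
  have "fps_const (\<i> * (\<i> * z)) - fps_const (\<i>\<^sup>2) * fps_X = - (fps_const z - fps_X)"
  proof -
    have "fps_const (\<i> * (\<i> * z)) = - fps_const z" "fps_const (\<i>\<^sup>2) = - 1"
      by (simp_all add: mult.assoc[symmetric] flip: fps_const_neg)
    then show ?thesis by simp
  qed
  then show "fps_deriv (Abs_fps (\<lambda>j. \<i> ^ j * (poly (hermite j) (\<i> * z) / fact j)))
    = - (fps_const z - fps_X) * Abs_fps (\<lambda>j. \<i> ^ j * (poly (hermite j) (\<i> * z) / fact j))"
    using fps_deriv_hermite[of \<i> "\<i> * z"] by simp
qed simp

lemma conv_inverse_exp:
  "conv_inverse (\<lambda>j. 1 / fact j :: complex) (\<lambda>j. (- 1) ^ j * (1 / fact j))"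
proof (rule conv_inverse_fps)
  have *: "fps_deriv (Abs_fps (\<lambda>j. w ^ j * (1 / fact j :: complex))) = fps_const w * Abs_fps (\<lambda>j. w ^ j * (1 / fact j))" for w
    by (rule fps_ext) (simp add: field_simps del: of_nat_Suc)
  show "fps_deriv (Abs_fps (\<lambda>j. 1 / fact j :: complex)) = 1 * Abs_fps (\<lambda>j. 1 / fact j)"
    using *[of 1] by simp
  have "fps_const (- 1 :: complex) = - 1" by (simp flip: fps_const_neg)
  then show "fps_deriv (Abs_fps (\<lambda>j. (- 1) ^ j * (1 / fact j) :: complex)) = - 1 * Abs_fps (\<lambda>j. (- 1) ^ j * (1 / fact j))"
    using *[of "- 1"] by simp
qed simp

text \<open>The factor \<open>w ^ (hs ! k - i)\<close> splits into a row and a column factor; moving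
  the row powers across avoids dividing by \<open>w\<close>.\<close>

lemma det_toeplitz_scale:
  "w ^ (\<Sum>i<length hs. i) * det (toeplitz (\<lambda>j. w ^ j * a j) hs) = w ^ sum_list hs * det (toeplitz a hs)"
proof -
  let ?n = "length hs"
  have "(\<Prod>i<?n. w ^ i) * (\<Prod>j<?n. 1) * det (toeplitz (\<lambda>j. w ^ j * a j) hs)
    = (\<Prod>i<?n. 1) * (\<Prod>j<?n. w ^ (hs ! j)) * det (toeplitz a hs)"
    unfolding toeplitz_def det_mat_scale[symmetric]
    using power_add[of w, symmetric] by (intro arg_cong[where f = det] eq_matI) (auto simp flip: mult.assoc)
  then show ?thesis by (simp add: power_sum sum_list_sum_nth atLeast0LessThan)
qed

section \<open>Hermite Wronskians as quotients of Toeplitz minors\<close>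

lemma pderiv_funpow_hermite:
  "(pderiv ^^ i) (hermite h) = (if i \<le> h then smult (fact h / fact (h - i)) (hermite (h - i)) else 0)"
proof (induction i)
  case (Suc i)
  consider "i < h" | "i = h" | "h < i" by linarith
  then show ?case
  proof cases
    case 1
    then obtain d where h: "h = i + Suc d" by (auto simp: less_iff_Suc_add)
    have "(pderiv ^^ Suc i) (hermite h) = smult (fact h / fact (Suc d) * of_nat (Suc d)) (hermite d)"
      using Suc by (simp add: h pderiv_smult pderiv_hermite_Suc del: of_nat_Suc fact_Suc)
    also have "fact h / fact (Suc d) * of_nat (Suc d) = (fact h / fact d :: complex)"
      by (simp add: fact_Suc[of d] del: of_nat_Suc)
    finally show ?thesis by (simp add: h)
  qed (use Suc in \<open>auto simp: pderiv_smult\<close>)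
qed simp

lemma poly_wronskian_hermite:
  "poly (wronskian (map hermite hs)) z
    = (\<Prod>k<length hs. fact (hs ! k)) * det (toeplitz (\<lambda>j. poly (hermite j) z / fact j) hs)"
proof -
  let ?n = "length hs"
  have "poly (wronskian (map hermite hs)) z = det (mat ?n ?n (\<lambda>(i, k). 1 *
     (if i \<le> hs ! k then poly (hermite (hs ! k - i)) z / fact (hs ! k - i) else 0) * fact (hs ! k)))"
    unfolding wronskian_def poly_det_mat
    by (intro arg_cong[where f = det] eq_matI) (auto simp: pderiv_funpow_hermite)
  then show ?thesis unfolding det_mat_scale by (simp add: toeplitz_def)
qed

text \<open>Falling factorials form a monic family, and they leave the same column factors as in
  \<open>poly_wronskian_hermite\<close>, so these cancel in the quotient.\<close>

lemma vandermonde_eq_det_toeplitz: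
  "vandermonde hs = (\<Prod>k<length hs. fact (hs ! k)) * det (toeplitz (\<lambda>j. 1 / fact j) hs)"
proof -
  let ?n = "length hs"
  have falling: "(\<Prod>t<i. of_nat h - of_nat t) = (if i \<le> h then fact h / fact (h - i) else 0 :: complex)" for i h
  proof (induction i)
    case (Suc i)
    show ?case
    proof (cases "i < h")
      case True
      then obtain d where h: "h = i + Suc d" by (auto simp: less_iff_Suc_add)
      have "(\<Prod>t<Suc i. of_nat h - of_nat t) = fact h / fact (Suc d) * (of_nat (Suc d) :: complex)"
        using Suc by (simp add: h del: fact_Suc)
      also have "\<dots> = fact h / fact d" by (simp add: fact_Suc[of d] del: of_nat_Suc)
      finally show ?thesis by (simp add: h)
    qed (use Suc in auto)
  qed simp
  have "vandermonde hs = det (mat ?n ?n (\<lambda>(i, k). poly (\<Prod>t<i. [:- of_nat t, 1:]) (of_nat (hs ! k))))"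
    by (rule vandermonde_eq_det[OF monic_family_prod_roots])
  also have "\<dots> = det (mat ?n ?n (\<lambda>(i, k). 1 *
     (if i \<le> hs ! k then 1 / fact (hs ! k - i) else 0) * fact (hs ! k)))"
    by (intro arg_cong[where f = det] eq_matI) (auto simp: poly_prod falling)
  finally show ?thesis unfolding det_mat_scale by (simp add: toeplitz_def)
qed

text \<open>The value of a Wronskian Hermite polynomial for degrees in any order: a reordering
  changes numerator and denominator by the same sign.\<close>

definition hermite_quotient :: "nat list \<Rightarrow> complex \<Rightarrow> complex" where
  "hermite_quotient hs z = poly (wronskian (map hermite hs)) z / vandermonde hs"

lemma hermite_quotient_toeplitz:
  "hermite_quotient hs z
    = det (toeplitz (\<lambda>j. poly (hermite j) z / fact j) hs) / det (toeplitz (\<lambda>j. 1 / fact j) hs)"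
  by (simp add: hermite_quotient_def poly_wronskian_hermite vandermonde_eq_det_toeplitz)

text \<open>The unknown factor of the complementary minor is the same in numerator and denominator.
  Scaling contributes powers of \<open>\<i>\<close> above and of -1 below, hence powers of
  \<open>- \<i>\<close> to the quotient.\<close>

lemma hermite_quotient_complement:
  assumes "distinct (xs @ map (\<lambda>y. N - 1 - y) ys)" "set (xs @ map (\<lambda>y. N - 1 - y) ys) = {..<N}"
    and "\<And>y. y \<in> set ys \<Longrightarrow> y < N"
  shows "(- \<i>) ^ (\<Sum>i<length ys. i) * hermite_quotient xs z = (- \<i>) ^ sum_list ys * hermite_quotient ys (\<i> * z)"
proof -
  obtain \<epsilon> where \<epsilon>: "\<epsilon> \<noteq> 0"
    "\<And>a b. a 0 = 1 \<Longrightarrow> conv_inverse a b \<Longrightarrow> det (toeplitz a xs) = \<epsilon> * det (toeplitz b ys)"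
    using det_toeplitz_complement[OF assms] by blast
  let ?s = "\<Sum>i<length ys. i" and ?t = "sum_list ys"
  define D where "D = det (toeplitz (\<lambda>j. poly (hermite j) (\<i> * z) / fact j) ys)"
  define E where "E = det (toeplitz (\<lambda>j. 1 / fact j) ys)"
  define D' where "D' = det (toeplitz (\<lambda>j. \<i> ^ j * (poly (hermite j) (\<i> * z) / fact j)) ys)"
  define E' where "E' = det (toeplitz (\<lambda>j. (- 1) ^ j * (1 / fact j)) ys)"
  have quot: "hermite_quotient xs z = D' / E'"
    unfolding hermite_quotient_toeplitz D'_def E'_def
    using \<epsilon>(1) \<epsilon>(2)[OF _ conv_inverse_hermite] \<epsilon>(2)[OF _ conv_inverse_exp] by simp
  have scale: "\<i> ^ ?s * D' = \<i> ^ ?t * D" "(- 1) ^ ?s * E' = (- 1) ^ ?t * E"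
    unfolding D_def D'_def E_def E'_def by (rule det_toeplitz_scale)+
  have pow: "(- \<i>) ^ n = \<i> ^ n / (- 1) ^ n" for n
    by (simp flip: power_divide)
  have "(- \<i>) ^ ?s * hermite_quotient xs z = (\<i> ^ ?s * D') / ((- 1) ^ ?s * E')"
    by (simp only: quot pow times_divide_times_eq)
  also have "\<dots> = (- \<i>) ^ ?t * (D / E)"
    by (simp only: scale pow times_divide_times_eq)
  also have "D / E = hermite_quotient ys (\<i> * z)"
    by (simp only: hermite_quotient_toeplitz D_def E_def)
  finally show ?thesis .
qed

text \<open>Both orderings have the same reflected complement \<open>xs\<close>, and the complement
  formula recovers the quotient from \<open>xs\<close> and the length and sum of the list.\<close>

lemma hermite_quotient_permute:
  assumes "distinct hs" "distinct hs'" "set hs = set hs'"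
  shows "hermite_quotient hs z = hermite_quotient hs' z"
proof -
  define N where "N = Suc (sum_list hs)"
  have N: "h < N" if "h \<in> set hs" for h using member_le_sum_list[OF that] by (simp add: N_def)
  define xs where "xs = filter (\<lambda>x. x \<notin> (\<lambda>y. N - 1 - y) ` set hs) [0..<N]"
  have inj: "inj_on (\<lambda>y. N - 1 - y) (set hs)"
  proof (rule inj_onI)
    fix x y assume "x \<in> set hs" "y \<in> set hs" "N - 1 - x = N - 1 - y"
    then show "x = y" using N[of x] N[of y] by linarith
  qed
  have sum: "sum_list hs = sum_list hs'"
    using sum_list_distinct_conv_sum_set[OF assms(1), of "\<lambda>x. x"]
      sum_list_distinct_conv_sum_set[OF assms(2), of "\<lambda>x. x"] assms(3) by simp
  have len: "length hs = length hs'"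
    using assms by (metis distinct_card)
  \<comment> \<open>Evaluating the \<open>xs\<close> side at \<open>- \<i> * z\<close> makes the
    argument on the \<open>ks\<close> side equal to \<open>z\<close>.\<close>
  have *: "(- \<i>) ^ (\<Sum>i<length ks. i) * hermite_quotient xs (- \<i> * z)
      = (- \<i>) ^ sum_list ks * hermite_quotient ks (\<i> * (- \<i> * z))"
    if ks: "distinct ks" "set ks = set hs" for ks
  proof (rule hermite_quotient_complement[where N = N])
    show "distinct (xs @ map (\<lambda>y. N - 1 - y) ks)"
      using ks inj by (auto simp: xs_def distinct_map)
    have "N - 1 - y < N" for y by (simp add: N_def)
    then show "set (xs @ map (\<lambda>y. N - 1 - y) ks) = {..<N}"
      unfolding set_append set_map ks(2) xs_def set_filter by auto
    show "y < N" if "y \<in> set ks" for y using that ks N by simp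
  qed
  have iz: "\<i> * (- \<i> * z) = z" by (simp flip: mult.assoc)
  have "(- \<i>) ^ sum_list hs * hermite_quotient hs z = (- \<i>) ^ sum_list hs * hermite_quotient hs' z"
    using *[of hs] *[of hs'] assms unfolding sum[symmetric] len[symmetric] iz by simp
  then show ?thesis by simp
qed

section \<open>Wronskians through the Euler operator; Laguerre polynomials\<close>

lemma funpow_pderiv_monom:
  fixes c :: complex
  shows "(pderiv ^^ i) (monom c p) = monom (c * (\<Prod>t<i. of_nat p - of_nat t)) (p - i)"
proof (induction i)
  case (Suc i)
  show ?case
  proof (cases "i \<le> p")
    case True
    then show ?thesis using Suc by (simp add: pderiv_monom of_nat_diff mult_ac)
  next
    case False
    \<comment> \<open>The factor with \<open>t = p\<close> vanishes, so the truncated exponent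
      \<open>p - i\<close> is harmless.\<close>
    then have "(\<Prod>t<i. of_nat p - of_nat t) = (0 :: complex)" by (auto intro!: bexI[of _ p])
    from Suc[unfolded this] this show ?thesis by (simp only: funpow.simps o_apply prod.lessThan_Suc) simp
  qed
qed simp

text \<open>Monomials are eigenvectors of \<open>z^i D^i\<close> with falling factorials as
  eigenvalues. The bound \<open>D\<close> may exceed the degree, so that all entries of a list can
  share it.\<close>

lemma poly_funpow_pderiv:
  fixes f :: "complex poly"
  assumes "degree f \<le> D"
  shows "z ^ i * poly ((pderiv ^^ i) f) z = (\<Sum>p\<le>D. coeff f p * z ^ p * (\<Prod>t<i. of_nat p - of_nat t))"
proof -
  have zero: "(\<Prod>t<i. of_nat p - of_nat t) = (0 :: complex)" if "p < i" for p
    using that by (auto intro!: bexI[of _ p])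
  have "(pderiv ^^ i) f = (\<Sum>p\<le>D. monom (coeff f p * (\<Prod>t<i. of_nat p - of_nat t)) (p - i))"
    by (subst poly_as_sum_of_monoms'[OF assms, symmetric]) (simp only: higher_pderiv_sum funpow_pderiv_monom)
  then have "z ^ i * poly ((pderiv ^^ i) f) z
      = (\<Sum>p\<le>D. z ^ i * (coeff f p * (\<Prod>t<i. of_nat p - of_nat t) * z ^ (p - i)))"
    by (simp add: poly_sum poly_monom sum_distrib_left)
  also have "\<dots> = (\<Sum>p\<le>D. coeff f p * z ^ p * (\<Prod>t<i. of_nat p - of_nat t))"
  proof (rule sum.cong)
    fix p
    show "z ^ i * (coeff f p * (\<Prod>t<i. of_nat p - of_nat t) * z ^ (p - i))
        = coeff f p * z ^ p * (\<Prod>t<i. of_nat p - of_nat t)"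
    proof (cases "p < i")
      case False
      then have "z ^ p = z ^ i * z ^ (p - i)" by (simp flip: power_add)
      then show ?thesis by simp
    qed (simp add: zero)
  qed simp
  finally show ?thesis .
qed

text \<open>With the Euler operator \<open>\<theta> = z D\<close> one has \<open>z\<^sup>i D\<^sup>i = \<theta> (\<theta> - 1) \<dots> (\<theta> - i + 1)\<close>, so the
  Wronskian may be computed with any monic family of polynomials in \<open>\<theta>\<close>.\<close>
lemma wronskian_euler:
  fixes z :: complex
  assumes "\<And>f. f \<in> set fs \<Longrightarrow> degree f \<le> D" "monic_family (length fs) q"
  shows "det (mat (length fs) (length fs) (\<lambda>(i, k). \<Sum>p\<le>D. coeff (fs ! k) p * z ^ p * poly (q i) (of_nat p)))
    = z ^ (\<Sum>i<length fs. i) * poly (wronskian fs) z"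
proof -
  let ?n = "length fs"
  have "det (mat ?n ?n (\<lambda>(i, k). \<Sum>p\<le>D. coeff (fs ! k) p * z ^ p * poly (q i) (of_nat p)))
    = det (mat ?n ?n (\<lambda>(i, k). \<Sum>p\<le>D. coeff (fs ! k) p * z ^ p * poly (\<Prod>t<i. [:- of_nat t, 1:]) (of_nat p)))"
    by (rule det_monic_family[OF assms(2) monic_family_prod_roots])
  also have "\<dots> = det (mat ?n ?n (\<lambda>(i, k). z ^ i * poly ((pderiv ^^ i) (fs ! k)) z * 1))"
    using assms(1)
    by (intro arg_cong[where f = det] eq_matI) (auto simp: poly_funpow_pderiv[where D = D] poly_prod)
  also have "\<dots> = z ^ (\<Sum>i<?n. i) * poly (wronskian fs) z"
    unfolding det_mat_scale by (simp add: wronskian_def poly_det_mat power_sum)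
  finally show ?thesis .
qed

section \<open>Coefficients of Hermite polynomials\<close>

lemma coeff_hermite_Suc_Suc:
  "coeff (hermite (Suc n)) (Suc p) = of_nat (Suc n) / of_nat (Suc p) * coeff (hermite n) p"
  using arg_cong[OF pderiv_hermite_Suc[of n], of "\<lambda>f. coeff f p"]
  by (simp add: coeff_pderiv field_simps del: of_nat_Suc hermite.simps)

text \<open>Repeated differentiation reduces every coefficient to a constant term.\<close>

lemma coeff_hermite_add:
  "coeff (hermite (n + p)) p = fact (n + p) / (fact n * fact p) * coeff (hermite n) 0"
proof (induction p)
  case (Suc p)
  then show ?case by (simp add: coeff_hermite_Suc_Suc field_simps del: of_nat_Suc hermite.simps)
qed simp

lemma coeff_hermite_above: "n < p \<Longrightarrow> coeff (hermite n) p = 0"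
proof (induction n arbitrary: p)
  case (Suc n)
  then obtain p' where "p = Suc p'" "n < p'" by (cases p) auto
  then show ?case using Suc by (simp add: coeff_hermite_Suc_Suc)
qed simp

lemma coeff_hermite_0_even: "coeff (hermite (2 * t)) 0 = (- 1) ^ t * fact (2 * t) / (fact t * 2 ^ t)"
proof (induction t)
  case (Suc t)
  have "coeff (hermite (2 * Suc t)) 0 = - of_nat (Suc (2 * t)) * coeff (hermite (2 * t)) 0"
    by (simp add: algebra_simps)
  also have "\<dots> = (- 1) ^ Suc t * (of_nat (2 * Suc t) * of_nat (Suc (2 * t)) * fact (2 * t)) / (of_nat (Suc t) * fact t * 2 ^ Suc t)"
    unfolding Suc by (simp add: divide_simps del: of_nat_Suc) (simp add: algebra_simps)
  finally show ?case by (simp add: mult_ac)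
qed simp

lemma coeff_hermite_0_odd: "coeff (hermite (Suc (2 * t))) 0 = 0"
  by (induction t) simp_all

lemma coeff_hermite:
  "coeff (hermite (p + 2 * t)) p = (- 1) ^ t * fact (p + 2 * t) / (fact p * fact t * 2 ^ t)"
  unfolding add.commute[of p] coeff_hermite_add coeff_hermite_0_even by (simp add: field_simps)

lemma coeff_hermite_odd:
  assumes "odd (n + p)"
  shows "coeff (hermite n) p = 0"
proof (cases "n < p")
  case False
  then have "odd (n - p)" using assms by auto
  then obtain t where "n - p = Suc (2 * t)" by (metis oddE Suc_eq_plus1)
  then have "n = Suc (2 * t) + p" using False by simp
  then show ?thesis by (simp only: coeff_hermite_add coeff_hermite_0_odd) simp
qed (simp add: coeff_hermite_above)

lemma coeff_hermite_self: "coeff (hermite n) n = 1"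
  using coeff_hermite[of n 0] by simp

lemma degree_hermite_le: "degree (hermite n) \<le> n"
  by (intro degree_le) (simp add: coeff_hermite_above)

section \<open>Laguerre polynomials: derivatives, contiguity, and \<open>T_poly\<close> as a
  Wronskian\<close>

lemma coeff_laguerre:
  "coeff (laguerre n \<alpha>) i
    = (if i \<le> n then (- 1) ^ i / (fact i * fact (n - i)) * (\<Prod>l = i + 1..n. \<alpha> + of_nat l) else 0)"
  by (simp add: laguerre_def coeff_sum)

lemma degree_laguerre_le: "degree (laguerre n \<alpha>) \<le> n"
  by (intro degree_le) (simp add: coeff_laguerre)

lemma pderiv_laguerre_Suc: "pderiv (laguerre (Suc n) \<alpha>) = - laguerre n (\<alpha> + 1)"
proof (rule poly_eqI)
  fix i
  have "(\<Prod>l = Suc (Suc i)..Suc n. \<alpha> + of_nat l) = (\<Prod>l = Suc i..n. \<alpha> + 1 + of_nat l)"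
    by (simp only: prod.shift_bounds_cl_Suc_ivl) (simp add: add_ac)
  then show "coeff (pderiv (laguerre (Suc n) \<alpha>)) i = coeff (- laguerre n (\<alpha> + 1)) i"
    by (simp add: coeff_pderiv coeff_laguerre field_simps del: of_nat_Suc)
qed

text \<open>The coefficients share the product \<open>Q\<close>; the remaining factors satisfy
  \<open>\<alpha> + i + 1 = (\<alpha> + n + 2) - (n + 1 - i)\<close>.\<close>

lemma laguerre_Suc_shift: "laguerre (Suc n) \<alpha> = laguerre (Suc n) (\<alpha> + 1) - laguerre n (\<alpha> + 1)"
proof (rule poly_eqI)
  fix i
  consider "i \<le> n" | "i = Suc n" | "Suc n < i" by linarith
  then show "coeff (laguerre (Suc n) \<alpha>) i = coeff (laguerre (Suc n) (\<alpha> + 1) - laguerre n (\<alpha> + 1)) i"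
  proof cases
    case 1
    then obtain d where n: "n = i + d" by (auto simp: le_iff_add)
    define Q where "Q = (\<Prod>l = Suc i..n. \<alpha> + 1 + of_nat l)"
    have 1: "(\<Prod>l = Suc i..Suc n. \<alpha> + of_nat l) = (\<alpha> + of_nat (Suc i)) * Q"
    proof -
      have "(\<Prod>l = Suc i..Suc n. \<alpha> + of_nat l)
          = (\<alpha> + of_nat (Suc i)) * (\<Prod>l = Suc (Suc i)..Suc n. \<alpha> + of_nat l)"
        using 1 by (intro prod.atLeast_Suc_atMost) simp
      also have "(\<Prod>l = Suc (Suc i)..Suc n. \<alpha> + of_nat l) = Q"
        by (simp only: prod.shift_bounds_cl_Suc_ivl) (simp add: Q_def add_ac)
      finally show ?thesis .
    qed
    have 2: "(\<Prod>l = Suc i..Suc n. \<alpha> + 1 + of_nat l) = (\<alpha> + 1 + of_nat (Suc n)) * Q"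
      using n by (simp add: Q_def mult.commute)
    have "(\<alpha> + of_nat (Suc i)) * Q / fact (Suc d)
        = (\<alpha> + 1 + of_nat (Suc n)) * Q / fact (Suc d) - Q / fact d"
    proof -
      have "Q / fact d = of_nat (Suc d) * Q / fact (Suc d)"
        by (simp add: field_simps del: of_nat_Suc)
      then show ?thesis by (simp add: n diff_divide_distrib[symmetric] algebra_simps del: fact_Suc)
    qed
    then have "(- 1) ^ i / fact i * ((\<alpha> + of_nat (Suc i)) * Q / fact (Suc d))
        = (- 1) ^ i / fact i * ((\<alpha> + 1 + of_nat (Suc n)) * Q / fact (Suc d) - Q / fact d)"
      by simp
    moreover have "Suc n - i = Suc d" "n - i = d" using n by auto
    ultimately show ?thesis using 1
      unfolding coeff_diff coeff_laguerre Suc_eq_plus1[symmetric] 1 2 Q_def[symmetric]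
      by (simp add: n right_diff_distrib del: fact_Suc of_nat_Suc)
  qed (simp_all add: coeff_laguerre)
qed

text \<open>Iterated contiguity turns a lowered parameter into a binomial difference in the degree.
  Each step uses the formula at \<open>M\<close> and at \<open>Suc M\<close>, so \<open>M\<close>
  stays arbitrary in the induction.\<close>

lemma laguerre_lower:
  "laguerre (M + i) (\<beta> - of_nat i)
    = (\<Sum>j\<le>i. smult ((- 1) ^ (i - j) * of_nat (i choose j)) (laguerre (M + j) \<beta>))"
proof (induction i arbitrary: M)
  case (Suc i)
  let ?L = "\<lambda>j. laguerre (M + j) \<beta>" and ?c = "\<lambda>i j. (- 1) ^ (i - j) * of_nat (i choose j) :: complex"
  have "laguerre (M + Suc i) (\<beta> - of_nat (Suc i))
      = laguerre (Suc M + i) (\<beta> - of_nat i) - laguerre (M + i) (\<beta> - of_nat i)"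
    using laguerre_Suc_shift[of "M + i" "\<beta> - of_nat (Suc i)"] by (simp add: algebra_simps)
  also have "\<dots> = (\<Sum>j\<le>i. smult (?c i j) (?L (Suc j))) - (\<Sum>j\<le>i. smult (?c i j) (?L j))"
    by (simp only: Suc[of M] Suc[of "Suc M"]) simp
  also have "(\<Sum>j\<le>i. smult (?c i j) (?L j)) = (\<Sum>j\<le>Suc i. smult (?c i j) (?L j))"
    by simp
  also have "\<dots> = smult (?c i 0) (?L 0) + (\<Sum>j\<le>i. smult (?c i (Suc j)) (?L (Suc j)))"
    by (rule sum.atMost_Suc_shift)
  also have "(\<Sum>j\<le>i. smult (?c i j) (?L (Suc j))) - (smult (?c i 0) (?L 0) + (\<Sum>j\<le>i. smult (?c i (Suc j)) (?L (Suc j))))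
    = smult (?c (Suc i) 0) (?L 0) + (\<Sum>j\<le>i. smult (?c i j - ?c i (Suc j)) (?L (Suc j)))"
    by (simp add: smult_diff_left sum_subtractf)
  also have "(\<Sum>j\<le>i. smult (?c i j - ?c i (Suc j)) (?L (Suc j))) = (\<Sum>j\<le>i. smult (?c (Suc i) (Suc j)) (?L (Suc j)))"
  proof (intro sum.cong refl arg_cong2[where f = smult])
    fix j assume "j \<in> {..i}"
    \<comment> \<open>This is Pascal's rule with signs; \<open>j = i\<close> is separate because the
      exponent \<open>i - Suc j\<close> truncates there.\<close>
    then consider "j = i" | d where "i = Suc (j + d)" by (metis atMost_iff le_neq_implies_less less_iff_Suc_add)
    then show "?c i j - ?c i (Suc j) = ?c (Suc i) (Suc j)"
      by cases (auto simp: algebra_simps)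
  qed
  also have "smult (?c (Suc i) 0) (?L 0) + \<dots> = (\<Sum>j\<le>Suc i. smult (?c (Suc i) j) (?L j))"
    by (rule sum.atMost_Suc_shift[symmetric])
  finally show ?case .
qed simp

lemma funpow_pderiv_laguerre:
  "(pderiv ^^ i) (laguerre (N + i) \<alpha>) = smult ((- 1) ^ i) (laguerre N (\<alpha> + of_nat i))"
proof (induction i arbitrary: N \<alpha>)
  case (Suc i)
  have "(pderiv ^^ Suc i) (laguerre (N + Suc i) \<alpha>) = pderiv (smult ((- 1) ^ i) (laguerre (Suc N) (\<alpha> + of_nat i)))"
    using Suc[of "Suc N" \<alpha>] by simp
  then show ?case by (simp add: pderiv_smult pderiv_laguerre_Suc add_ac)
qed simp

text \<open>Reversing the nodes \<open>0, ..., n - 1\<close> negates every Vandermonde factor, and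
  the nonzero Vandermonde determinant can then be cancelled.\<close>

lemma det_reversal:
  "det (mat n n (\<lambda>(i, k). if i = n - 1 - k then 1 else 0 :: complex)) = (- 1) ^ (\<Sum>i<n. i)"
proof -
  define V where "V = vandermonde [0..<n]"
  let ?R = "\<lambda>i k. if i = n - 1 - k then 1 else 0 :: complex"
  have "V \<noteq> 0" by (auto simp: V_def vandermonde_def)
  have mono: "monic_family n (\<lambda>i. monom 1 i :: complex poly)"
    by (simp add: monic_family_def degree_monom_eq)
  have "vandermonde (rev [0..<n]) = (\<Prod>k<n. \<Prod>j<k. - 1 * (of_nat k - of_nat j))"
    unfolding vandermonde_def
  proof (simp only: length_rev length_upt diff_zero, intro prod.cong refl)
    fix k j assume "k \<in> {..<n}" "j \<in> {..<k}"
    then show "of_nat (rev [0..<n] ! k) - of_nat (rev [0..<n] ! j) = - 1 * (of_nat k - of_nat j :: complex)"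
      by (simp add: rev_nth of_nat_diff)
  qed
  also have "\<dots> = (- 1) ^ (\<Sum>i<n. i) * V"
    by (simp add: V_def vandermonde_def prod.distrib power_sum del: mult_minus1 mult_minus_left)
  finally have "(- 1) ^ (\<Sum>i<n. i) * V = vandermonde (rev [0..<n])" by simp
  also have "\<dots> = det (mat n n (\<lambda>(i, k). \<Sum>l<n. of_nat l ^ i * ?R l k))"
    using vandermonde_eq_det[of "rev [0..<n]" "\<lambda>i. monom 1 i"] mono
    by (auto simp: poly_monom rev_nth if_distrib[of "\<lambda>x. _ * x"] cong: if_cong
        intro!: arg_cong[where f = det] eq_matI)
  also have "\<dots> = V * det (mat n n (\<lambda>(i, k). ?R i k))"
    using vandermonde_eq_det[of "[0..<n]" "\<lambda>i. monom 1 i"] mono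
    unfolding det_mat_mult
    by (auto simp: V_def poly_monom intro!: arg_cong[where f = det] eq_matI)
  finally show ?thesis using \<open>V \<noteq> 0\<close> by simp
qed

text \<open>Column \<open>k\<close> of the determinant holds derivatives of \<open>(- 1) ^ k\<close>
  times the Laguerre polynomial of degree \<open>m + n - k\<close> and parameter
  \<open>\<beta> - (n - 1 - k)\<close>. By contiguity this is a unitriangular combination of the
  polynomials with parameter \<open>\<beta>\<close>.\<close>

lemma poly_T_poly:
  "poly (T_poly m n (\<beta> - of_nat n)) u = poly (wronskian (map (\<lambda>j. laguerre (m + 1 + j) \<beta>) [0..<n])) u"
proof -
  let ?L = "\<lambda>j. laguerre (m + 1 + j) \<beta>"
  let ?c = "\<lambda>l i. if l \<le> i then (- 1) ^ (i - l) * of_nat (i choose l) else 0 :: complex"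
  have entry: "(pderiv ^^ (j + k)) (laguerre (m + n) (\<beta> - of_nat n + 1))
     = smult ((- 1) ^ k) (\<Sum>l<n. smult (?c l (n - 1 - k)) ((pderiv ^^ j) (?L l)))" if "k < n" for j k
  proof -
    define i where "i = n - 1 - k"
    have n: "n = Suc (i + k)" using that by (simp add: i_def)
    have "(pderiv ^^ k) (laguerre (m + n) (\<beta> - of_nat n + 1)) = smult ((- 1) ^ k) (laguerre (m + 1 + i) (\<beta> - of_nat i))"
      using funpow_pderiv_laguerre[of k "m + 1 + i" "\<beta> - of_nat n + 1"] by (simp add: n add_ac algebra_simps)
    also have "laguerre (m + 1 + i) (\<beta> - of_nat i) = (\<Sum>l<n. smult (?c l i) (?L l))"
      unfolding laguerre_lower by (rule sum.mono_neutral_cong_left) (auto simp: n)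
    finally show ?thesis by (simp only: funpow_add o_apply higher_pderiv_smult higher_pderiv_sum i_def)
  qed
  have "poly (T_poly m n (\<beta> - of_nat n)) u
    = det (mat n n (\<lambda>(j, k). 1 * (\<Sum>l<n. poly ((pderiv ^^ j) (?L l)) u * ?c l (n - 1 - k)) * (- 1) ^ k))"
    unfolding T_poly_def poly_det_mat
    by (intro arg_cong[where f = det] eq_matI) (simp_all add: entry poly_sum mult_ac cong: if_cong)
  also have "\<dots> = (- 1) ^ (\<Sum>i<n. i) * (det (mat n n (\<lambda>(j, l). poly ((pderiv ^^ j) (?L l)) u))
      * det (mat n n (\<lambda>(l, k). ?c l (n - 1 - k))))"
    unfolding det_mat_scale det_mat_mult by (simp add: power_sum)
  \<comment> \<open>The coefficient matrix is unitriangular times a reversal, whose sign cancels the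
    one from the column factors \<open>(- 1) ^ k\<close>.\<close>
  also have "det (mat n n (\<lambda>(l, k). ?c l (n - 1 - k)))
     = det (mat n n (\<lambda>(l, k). \<Sum>p<n. ?c l p * (if p = n - 1 - k then 1 else 0)))"
    by (intro arg_cong[where f = det] eq_matI) (auto simp: if_distrib[of "\<lambda>x. _ * x"] cong: if_cong)
  also have "\<dots> = (- 1) ^ (\<Sum>i<n. i)"
    unfolding det_mat_mult det_reversal by (subst det_mat_upper_triangular) auto
  also have "det (mat n n (\<lambda>(j, l). poly ((pderiv ^^ j) (?L l)) u)) = poly (wronskian (map ?L [0..<n])) u"
    unfolding wronskian_def poly_det_mat
    by (auto intro!: arg_cong[where f = det] eq_matI)
  finally show ?thesis by (simp flip: power_mult_distrib)
qed

section \<open>From Hermite to Laguerre: \<open>odd_factor r p\<close> is the eigenvalue of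
  \<open>q_r(theta)\<close> on \<open>z^p\<close>\<close>

definition odd_factor :: "nat \<Rightarrow> nat \<Rightarrow> complex" where
  "odd_factor r p = (\<Prod>t<r. of_nat p - of_nat (2 * t + 1))"

text \<open>The factors for \<open>2 N + 2\<close> run from \<open>2 N + 1\<close> down to
  \<open>2 N + 3 - 2 r\<close>, those for \<open>2 N\<close> from \<open>2 N - 1\<close> down to
  \<open>2 N + 1 - 2 r\<close>; only the end factors differ.\<close>

lemma odd_factor_step:
  "odd_factor r (2 * Suc N) * (of_nat (2 * N + 1) - of_nat (2 * r)) = of_nat (2 * N + 1) * odd_factor r (2 * N)"
proof (induction r)
  case (Suc r)
  have "odd_factor (Suc r) (2 * Suc N) * (of_nat (2 * N + 1) - of_nat (2 * Suc r))
     = (odd_factor r (2 * Suc N) * (of_nat (2 * N + 1) - of_nat (2 * r))) * (of_nat (2 * N) - of_nat (2 * r + 1))"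
    by (simp add: odd_factor_def algebra_simps)
  then show ?case unfolding Suc by (simp add: odd_factor_def)
qed (simp add: odd_factor_def)

lemma odd_factor_add: "odd_factor (r + i) p = odd_factor r p * (\<Prod>t<i. of_nat p - of_nat (2 * (r + t) + 1))"
  by (induction i) (simp_all add: odd_factor_def)

lemma odd_factor_odd_eq_0: "s < i \<Longrightarrow> odd_factor i (2 * s + 1) = 0"
  by (auto simp: odd_factor_def intro!: bexI[of _ s])

lemma odd_factor_odd_self: "odd_factor k (2 * k + 1) = 2 ^ k * fact k"
proof -
  have "odd_factor k (2 * k + 1) = (\<Prod>t<k. 2 * of_nat (k - t))"
    unfolding odd_factor_def by (intro prod.cong) (auto simp: of_nat_diff)
  also have "\<dots> = 2 ^ k * fact k"
    by (simp only: prod.distrib prod_constant fact_prod_rev of_nat_prod atLeast0LessThan card_lessThan)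
  finally show ?thesis .
qed

text \<open>The comparison of Hermite and Laguerre coefficients, cleared of denominators. In the
  induction \<open>odd_factor_step\<close> supplies the new Laguerre factor
  \<open>(2 N + 1 - 2 r) / 2 = - 1 / 2 - r + (N + 1)\<close>.\<close>

lemma odd_factor_laguerre_ratio:
  "fact (2 * (s + t)) * odd_factor r (2 * s) * fact s
    = 4 ^ t * fact (s + t) * fact (2 * s) * odd_factor r (2 * (s + t))
      * (\<Prod>l = s + 1..s + t. (- 1 / 2 - of_nat r) + of_nat l)"
proof (induction t)
  case (Suc t)
  define N where "N = s + t"
  define X where "X = (\<Prod>l = s + 1..s + t. (- 1 / 2 - of_nat r :: complex) + of_nat l)"
  have X: "(\<Prod>l = s + 1..s + Suc t. (- 1 / 2 - of_nat r :: complex) + of_nat l) = X * ((of_nat (2 * N + 1) - of_nat (2 * r)) / 2)"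
    by (simp add: X_def N_def field_simps)
  have "fact (2 * Suc N) * odd_factor r (2 * s) * fact s
     = of_nat (2 * Suc N) * of_nat (2 * N + 1) * (fact (2 * N) * odd_factor r (2 * s) * fact s)"
    by (simp add: algebra_simps)
  also have "\<dots> = of_nat (2 * Suc N) * of_nat (2 * N + 1)
     * (4 ^ t * fact N * fact (2 * s) * odd_factor r (2 * N) * X)"
    using Suc by (simp only: N_def X_def)
  also have "\<dots> = of_nat (2 * Suc N) * (of_nat (2 * N + 1) * odd_factor r (2 * N)) * 4 ^ t * fact N * fact (2 * s) * X"
    by (simp only: mult_ac)
  also have "\<dots> = 4 ^ Suc t * fact (Suc N) * fact (2 * s) * odd_factor r (2 * Suc N) * (X * ((of_nat (2 * N + 1) - of_nat (2 * r)) / 2))"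
    unfolding odd_factor_step[symmetric] by (simp only: fact_Suc power_Suc of_nat_mult) simp
  finally show ?case unfolding X by (simp only: N_def add_Suc_right)
qed simp

text \<open>In operator form, \<open>q_r(theta)\<close> maps \<open>hermite (2 * N)\<close> to a
  multiple of the Laguerre polynomial with parameter \<open>- 1 / 2 - r\<close> in
  \<open>z^2 / 2\<close>; \<open>r = 0\<close> is the classical relation.\<close>

lemma hermite_laguerre_coeff:
  "coeff (hermite (2 * N)) (2 * s) * odd_factor r (2 * s)
    = (- 2) ^ N * fact N * odd_factor r (2 * N) * (coeff (laguerre N (- 1 / 2 - of_nat r)) s / 2 ^ s)"
proof (cases "s \<le> N")
  case True
  then obtain t where N: "N = s + t" by (auto simp: le_iff_add)
  define X where "X = (\<Prod>l = s + 1..s + t. (- 1 / 2 - of_nat r :: complex) + of_nat l)"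
  have lag: "coeff (laguerre N (- 1 / 2 - of_nat r)) s = (- 1) ^ s / (fact s * fact t) * X"
    by (simp add: coeff_laguerre N X_def)
  have her: "coeff (hermite (2 * N)) (2 * s) = (- 1) ^ t * fact (2 * N) / (fact (2 * s) * fact t * 2 ^ t)"
    using coeff_hermite[of "2 * s" t] by (simp add: N distrib_left)
  have "(4 :: complex) ^ t = 2 ^ t * 2 ^ t" by (simp flip: power_mult_distrib)
  then have "fact (2 * N) * odd_factor r (2 * s) / (fact (2 * s) * 2 ^ t) = 2 ^ t * fact N * odd_factor r (2 * N) * X / fact s"
    using odd_factor_laguerre_ratio[of s t r] by (simp add: field_simps N X_def)
  then have "(- 1) ^ t / fact t * (fact (2 * N) * odd_factor r (2 * s) / (fact (2 * s) * 2 ^ t))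
    = (- 1) ^ t / fact t * (2 ^ t * fact N * odd_factor r (2 * N) * X / fact s)" by simp
  moreover have "(- 2 :: complex) ^ N = (- 1) ^ s * (- 1) ^ t * 2 ^ s * 2 ^ t"
    using power_minus[of "2 :: complex" N] by (simp add: N power_add mult_ac)
  ultimately show ?thesis unfolding lag her by (simp add: mult_ac flip: power_mult_distrib)
qed (simp add: coeff_hermite_above coeff_laguerre)

text \<open>The family \<open>q\<^sub>i(\<theta>) = (\<theta> - 1) (\<theta> - 3) \<dots> (\<theta> - 2 i + 1)\<close> kills odd polynomials of degree less than
  \<open>2 i\<close>, so it makes the block of odd Hermite polynomials triangular; on an even Hermite
  polynomial \<open>q\<^sub>r(\<theta>)\<close> produces a Laguerre polynomial in \<open>z\<^sup>2 / 2\<close>.\<close>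
lemma wronskian_odd_even_hermite:
  fixes z :: complex
  defines "u \<equiv> z\<^sup>2 / 2"
  shows "z ^ (\<Sum>i<r + n. i) * poly (wronskian (map (\<lambda>j. hermite (1 + 2 * j)) [0..<r]
            @ map (\<lambda>j. hermite (2 * (m + 1 + j))) [0..<n])) z
    = (\<Prod>k<r. 2 ^ k * fact k * z ^ (2 * k + 1))
      * ((\<Prod>i<n. 2 ^ i) * (\<Prod>j<n. (- 2) ^ (m + 1 + j) * fact (m + 1 + j) * odd_factor r (2 * (m + 1 + j)))
         * (u ^ (\<Sum>i<n. i) * poly (wronskian (map (\<lambda>j. laguerre (m + 1 + j) (- 1 / 2 - of_nat r)) [0..<n])) u))"
proof -
  let ?fs = "map (\<lambda>j. hermite (1 + 2 * j)) [0..<r] @ map (\<lambda>j. hermite (2 * (m + 1 + j))) [0..<n]"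
  let ?ls = "map (\<lambda>j. laguerre (m + 1 + j) (- 1 / 2 - of_nat r)) [0..<n]"
  define D where "D = m + n + r"
  \<comment> \<open>The odd bound lets the sum over \<open>p\<close> be grouped into pairs
    \<open>2 s\<close>, \<open>2 s + 1\<close> with \<open>s \<le> D\<close>.\<close>
  define E where "E = Suc (2 * D)"
  let ?q = "\<lambda>i. \<Prod>t<i. [:- of_nat (2 * t + 1), 1 :: complex:]"
  \<comment> \<open>The Euler operator in \<open>z\<close> is twice that in \<open>u\<close>, so the
    factors of \<open>q_(r+i)\<close> beyond \<open>q_r\<close> have roots
    \<open>(2 (r + t) + 1) / 2\<close> in the latter and leave a factor 2 each.\<close>
  let ?q' = "\<lambda>i. \<Prod>t<i. [:- (1 / 2 + of_nat (r + t)), 1 :: complex:]"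
  define M where "M = (\<lambda>i k. \<Sum>p\<le>E. coeff (?fs ! k) p * z ^ p * odd_factor i p)"
  have q: "poly (?q i) (of_nat p) = odd_factor i p" for i p
    unfolding poly_prod odd_factor_def by (intro prod.cong) simp_all
  have deg: "degree f \<le> E" if "f \<in> set ?fs" for f
    using that
    by (auto intro!: order.trans[OF degree_hermite_le] simp: E_def D_def simp del: hermite.simps)
  have odd: "M i k = (if i = k then 2 ^ k * fact k * z ^ (2 * k + 1) else 0)" if "k \<le> i" "k < r" for i k
  proof -
    have "M i k = (\<Sum>p\<le>E. if p = 2 * k + 1 then (if i = k then 2 ^ k * fact k * z ^ (2 * k + 1) else 0) else 0)"
      unfolding M_def
    proof (rule sum.cong)
      fix p
      have fs: "?fs ! k = hermite (1 + 2 * k)" using that by (simp add: nth_append)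
      show "coeff (?fs ! k) p * z ^ p * odd_factor i p
         = (if p = 2 * k + 1 then (if i = k then 2 ^ k * fact k * z ^ (2 * k + 1) else 0) else 0)"
      \<comment> \<open>Only exponents \<open>p = 2 s + 1\<close> with \<open>s \<le> k\<close> can
        contribute, and \<open>odd_factor i\<close> kills those with \<open>s < i\<close>; as
        \<open>k \<le> i\<close>, a term survives only for \<open>s = k = i\<close>.\<close>
      proof (cases "even p \<or> p > 1 + 2 * k")
        case True
        then have "coeff (hermite (1 + 2 * k)) p = 0"
          using coeff_hermite_odd[of "1 + 2 * k" p] coeff_hermite_above[of "1 + 2 * k" p] by auto
        then show ?thesis using True unfolding fs by auto
      next
        case False
        then obtain s where p: "p = 2 * s + 1" by (auto elim: oddE)
        then have "s \<le> k" using False by simp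
        show ?thesis
        proof (cases "s = k")
          case True
          then show ?thesis using that unfolding fs p
            using coeff_hermite_self[of "1 + 2 * k"] odd_factor_odd_self[of k] odd_factor_odd_eq_0[of k i]
            by (cases "i = k") (simp_all del: hermite.simps)
        next
          case neq: False
          then show ?thesis using that \<open>s \<le> k\<close> odd_factor_odd_eq_0[of s i] p by simp
        qed
      qed
    qed simp
    then show ?thesis using that by (simp add: E_def D_def del: sum.atMost_Suc)
  qed
  let ?C = "\<lambda>j. (- 2) ^ (m + 1 + j) * fact (m + 1 + j) * odd_factor r (2 * (m + 1 + j))"
  have even: "M (r + i) (r + j) = 2 ^ i * (\<Sum>s\<le>D. coeff (?ls ! j) s * u ^ s * poly (?q' i) (of_nat s)) * ?C j"
    if "j < n" for i j
  proof -
    define N where "N = m + 1 + j"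
    have fs: "?fs ! (r + j) = hermite (2 * N)" and ls: "?ls ! j = laguerre N (- 1 / 2 - of_nat r)"
      using that by (simp_all add: nth_append N_def)
    have "M (r + i) (r + j) = (\<Sum>s\<le>D. coeff (hermite (2 * N)) (2 * s) * z ^ (2 * s) * odd_factor (r + i) (2 * s))"
      unfolding M_def E_def sum.in_pairs_0 fs by (simp add: coeff_hermite_odd)
    also have "\<dots> = (\<Sum>s\<le>D. 2 ^ i * (coeff (laguerre N (- 1 / 2 - of_nat r)) s * u ^ s * poly (?q' i) (of_nat s)) * ?C j)"
    proof (rule sum.cong)
      fix s
      have "(\<Prod>t<i. of_nat (2 * s) - of_nat (2 * (r + t) + 1)) = (\<Prod>t<i. 2 * (of_nat s - (1 / 2 + of_nat (r + t))) :: complex)"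
        by (intro prod.cong refl) (simp add: algebra_simps)
      also have "\<dots> = 2 ^ i * (\<Prod>t<i. of_nat s - (1 / 2 + of_nat (r + t)))"
        by (simp only: prod.distrib prod_constant card_lessThan)
      also have "(\<Prod>t<i. of_nat s - (1 / 2 + of_nat (r + t))) = poly (?q' i) (of_nat s)"
        unfolding poly_prod by (intro prod.cong refl) (simp add: algebra_simps)
      finally have of: "odd_factor (r + i) (2 * s) = odd_factor r (2 * s) * (2 ^ i * poly (?q' i) (of_nat s))"
        by (simp only: odd_factor_add)
      have u: "u ^ s = z ^ (2 * s) / 2 ^ s" by (simp add: u_def power_divide power_mult)
      have "coeff (hermite (2 * N)) (2 * s) * z ^ (2 * s) * odd_factor (r + i) (2 * s)
        = (coeff (hermite (2 * N)) (2 * s) * odd_factor r (2 * s)) * z ^ (2 * s) * (2 ^ i * poly (?q' i) (of_nat s))"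
        unfolding of by (simp only: mult_ac)
      also have "\<dots> = 2 ^ i * (coeff (laguerre N (- 1 / 2 - of_nat r)) s * u ^ s * poly (?q' i) (of_nat s)) * ?C j"
        unfolding hermite_laguerre_coeff u N_def[symmetric]
        by (simp only: times_divide_eq_left times_divide_eq_right mult_ac)
      finally show "coeff (hermite (2 * N)) (2 * s) * z ^ (2 * s) * odd_factor (r + i) (2 * s)
        = 2 ^ i * (coeff (laguerre N (- 1 / 2 - of_nat r)) s * u ^ s * poly (?q' i) (of_nat s)) * ?C j" .
    qed simp
    finally show ?thesis unfolding ls by (simp only: sum_distrib_left sum_distrib_right)
  qed
  have "z ^ (\<Sum>i<r + n. i) * poly (wronskian ?fs) z = det (mat (r + n) (r + n) (\<lambda>(i, k). M i k))"
    using wronskian_euler[of ?fs E ?q z, OF deg monic_family_prod_roots]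
    unfolding q M_def by (simp only: length_append length_map length_upt diff_zero)
  also have "\<dots> = det (mat r r (\<lambda>(i, k). M i k)) * det (mat n n (\<lambda>(i, j). M (r + i) (r + j)))"
    by (rule det_mat_block_upper) (use odd in auto)
  also have "det (mat r r (\<lambda>(i, k). M i k)) = (\<Prod>k<r. 2 ^ k * fact k * z ^ (2 * k + 1))"
    by (subst det_mat_upper_triangular) (use odd in \<open>auto intro!: prod.cong\<close>)
  also have "det (mat n n (\<lambda>(i, j). M (r + i) (r + j)))
     = det (mat n n (\<lambda>(i, j). 2 ^ i * (\<Sum>s\<le>D. coeff (?ls ! j) s * u ^ s * poly (?q' i) (of_nat s)) * ?C j))"
    by (intro arg_cong[where f = det] eq_matI) (simp_all only: dim_row_mat dim_col_mat index_mat even split)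
  also have "\<dots> = (\<Prod>i<n. 2 ^ i) * (\<Prod>j<n. ?C j)
     * det (mat n n (\<lambda>(i, j). \<Sum>s\<le>D. coeff (?ls ! j) s * u ^ s * poly (?q' i) (of_nat s)))"
    by (rule det_mat_scale)
  also have "det (mat n n (\<lambda>(i, j). \<Sum>s\<le>D. coeff (?ls ! j) s * u ^ s * poly (?q' i) (of_nat s)))
     = u ^ (\<Sum>i<n. i) * poly (wronskian ?ls) u"
  proof -
    have "degree f \<le> D" if "f \<in> set ?ls" for f
      using that by (auto intro!: order.trans[OF degree_laguerre_le] simp: D_def)
    from wronskian_euler[of ?ls D ?q' u, OF this monic_family_prod_roots] show ?thesis
      by (simp only: length_map length_upt diff_zero)
  qed
  finally show ?thesis .
qed

section \<open>Degree vectors\<close>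

lemma length_degree_vector [simp]: "length (degree_vector ps) = length ps"
  by (simp add: degree_vector_def)

lemma nth_degree_vector: "j < length ps \<Longrightarrow> degree_vector ps ! j = ps ! j + (length ps - (j + 1))"
  by (simp add: degree_vector_def)

lemma distinct_degree_vector:
  assumes "sorted_wrt (\<ge>) ps"
  shows "distinct (degree_vector ps)"
proof -
  have "degree_vector ps ! j < degree_vector ps ! i" if "i < j" "j < length ps" for i j
    using sorted_wrt_nth_less[OF assms that] that by (simp add: nth_degree_vector)
  then show ?thesis
    unfolding distinct_conv_nth length_degree_vector by (metis linorder_neqE_nat nat_neq_iff)
qed

text \<open>In a weakly decreasing list the entries that are at least \<open>a\<close> form an
  initial segment.\<close>

lemma less_length_filter_ge:
  fixes ps :: "nat list"
  assumes "sorted_wrt (\<ge>) ps"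
  shows "i < length (filter (\<lambda>p. a \<le> p) ps) \<longleftrightarrow> i < length ps \<and> a \<le> ps ! i"
  using assms
proof (induction ps arbitrary: i)
  case (Cons x xs)
  show ?case
  proof (cases "a \<le> x")
    case True
    then show ?thesis using Cons by (cases i) auto
  next
    case False
    then have small: "\<forall>y\<in>set (x # xs). \<not> a \<le> y" using Cons.prems by auto
    then have "\<not> (i < length (x # xs) \<and> a \<le> (x # xs) ! i)" using nth_mem by blast
    moreover have "filter (\<lambda>p. a \<le> p) (x # xs) = []" using small by (simp add: filter_empty_conv)
    ultimately show ?thesis by (simp only: list.size) simp
  qed
qed simp

lemma length_conjugate_partition: "ps \<noteq> [] \<Longrightarrow> length (conjugate_partition ps) = hd ps"
  by (simp add: conjugate_partition_def)

text \<open>Both sides express that the cell \<open>(i, j)\<close> lies in the Young diagram of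
  \<open>ps\<close>.\<close>

lemma less_nth_conjugate_partition:
  assumes "sorted_wrt (\<ge>) ps" "ps \<noteq> []" "j < hd ps"
  shows "i < conjugate_partition ps ! j \<longleftrightarrow> i < length ps \<and> j < ps ! i"
proof -
  have "conjugate_partition ps ! j = length (filter (\<lambda>p. Suc j \<le> p) ps)"
    using assms(2,3) by (simp add: conjugate_partition_def del: upt_Suc)
  then show ?thesis
    by (simp only: less_length_filter_ge[OF assms(1)] Suc_le_eq[of j "ps ! i"])
qed

lemma sorted_conjugate_partition:
  assumes "sorted_wrt (\<ge>) ps"
  shows "sorted_wrt (\<ge>) (conjugate_partition ps)"
proof (cases "ps = []")
  case False
  show ?thesis
    unfolding sorted_wrt_iff_nth_less length_conjugate_partition[OF False]
  proof (intro allI impI)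
    fix i j assume "i < j" "j < hd ps"
    then have "l < conjugate_partition ps ! i" if "l < conjugate_partition ps ! j" for l
      using that less_nth_conjugate_partition[OF assms False] by auto
    then show "conjugate_partition ps ! j \<le> conjugate_partition ps ! i"
      by (meson not_le less_irrefl)
  qed
qed (simp add: conjugate_partition_def)

text \<open>The degree vectors of a partition and of its conjugate are, up to a reflection, complementary
  subsets of an initial segment of the naturals.\<close>
lemma degree_vector_conjugate:
  fixes ps :: "nat list"
  assumes "sorted_wrt (\<ge>) ps" "ps \<noteq> []"
  defines "N \<equiv> length ps + hd ps"
  shows "distinct (degree_vector (conjugate_partition ps) @ map (\<lambda>y. N - 1 - y) (degree_vector ps))"
    and "set (degree_vector (conjugate_partition ps) @ map (\<lambda>y. N - 1 - y) (degree_vector ps)) = {..<N}"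
    and "\<And>y. y \<in> set (degree_vector ps) \<Longrightarrow> y < N"
proof -
  let ?qs = "conjugate_partition ps"
  let ?xs = "degree_vector ?qs" and ?ys = "map (\<lambda>y. N - 1 - y) (degree_vector ps)"
  have len: "length ?qs = hd ps" using assms(2) by (rule length_conjugate_partition)
  have hd: "ps ! i \<le> hd ps" if "i < length ps" for i
    using assms(1) that sorted_wrt_nth_less[OF assms(1), of 0 i]
    by (cases "i = 0") (simp_all add: hd_conv_nth[OF assms(2)])
  have q: "?qs ! j \<le> length ps" if "j < hd ps" for j
    using less_nth_conjugate_partition[OF assms(1,2) that, of "length ps"] by simp
  show lt: "y < N" if "y \<in> set (degree_vector ps)" for y
    using that hd by (fastforce simp: in_set_conv_nth nth_degree_vector N_def)
  have x: "?xs ! j = ?qs ! j + (hd ps - Suc j)" if "j < hd ps" for j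
    using that len by (simp add: nth_degree_vector)
  have y: "?ys ! i + ps ! i = hd ps + i" if "i < length ps" for i
    using that hd[OF that] by (simp add: nth_degree_vector N_def)
  have "inj_on (\<lambda>y. N - 1 - y) (set (degree_vector ps))"
  proof (rule inj_onI)
    fix a b assume "a \<in> set (degree_vector ps)" "b \<in> set (degree_vector ps)" "N - 1 - a = N - 1 - b"
    then show "a = b" using lt[of a] lt[of b] by linarith
  qed
  then have "distinct ?xs" "distinct ?ys"
    using distinct_degree_vector assms(1) sorted_conjugate_partition by (auto simp: distinct_map)
  moreover have "?xs ! j \<noteq> ?ys ! i" if "j < hd ps" "i < length ps" for i j
  proof
    assume "?xs ! j = ?ys ! i"
    \<comment> \<open>If the cell \<open>(i, j)\<close> lies in the diagram, this sum is at least
      \<open>i + j + 2\<close>, otherwise at most \<open>i + j\<close>; the value in between is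
      impossible.\<close>
    then have "?qs ! j + ps ! i = Suc (i + j)" using x[OF that(1)] y[OF that(2)] that by simp
    then show False
      using less_nth_conjugate_partition[OF assms(1,2) that(1), of i] that by linarith
  qed
  then have "set ?xs \<inter> set ?ys = {}"
    by (force simp: in_set_conv_nth len simp del: set_map nth_map)
  ultimately show d: "distinct (?xs @ ?ys)" by simp
  have "set (?xs @ ?ys) \<subseteq> {..<N}"
  proof
    fix v assume "v \<in> set (?xs @ ?ys)"
    then consider j where "j < hd ps" "v = ?xs ! j" | y where "v = N - 1 - y"
      by (auto simp: in_set_conv_nth[of _ ?xs] len)
    then show "v \<in> {..<N}"
    proof cases
      case 1
      then show ?thesis using x q by (fastforce simp: N_def)
    next
      case 2
      then show ?thesis using assms(2) by (simp add: N_def)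
    qed
  qed
  moreover have "card (set (?xs @ ?ys)) = N"
    using distinct_card[OF d] len by (simp add: N_def)
  ultimately show "set (?xs @ ?ys) = {..<N}" by (intro card_subset_eq) auto
qed

section \<open>The degrees belonging to \<open>Lambda\<close>, with the odd ones listed
  first\<close>

definition odd_even_degrees :: "nat \<Rightarrow> nat \<Rightarrow> nat \<Rightarrow> nat list" where
  "odd_even_degrees k m n = map (\<lambda>j. 1 + 2 * j) [0..<n + k] @ map (\<lambda>j. 2 * (m + 1 + j)) [0..<n]"

lemma length_odd_even_degrees [simp]: "length (odd_even_degrees k m n) = 2 * n + k"
  by (simp add: odd_even_degrees_def)

lemma distinct_odd_even_degrees: "distinct (odd_even_degrees k m n)"
proof -
  have "1 + 2 * i \<noteq> 2 * (m + 1 + j)" for i j by presburger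
  then show ?thesis by (auto simp: odd_even_degrees_def distinct_map inj_on_def)
qed

lemma in_odd_even_degrees_iff:
  "x \<in> set (odd_even_degrees k m n) \<longleftrightarrow>
    (if odd x then x < 2 * (n + k) else 2 * (m + 1) \<le> x \<and> x \<le> 2 * (m + n))"
proof (cases "odd x")
  case True
  then obtain i where "x = 2 * i + 1" by (auto elim: oddE)
  then show ?thesis by (auto simp: odd_even_degrees_def; presburger)
next
  case False
  then obtain i where x: "x = 2 * i" by (auto elim: evenE)
  have "x \<in> set (odd_even_degrees k m n) \<longleftrightarrow> (\<exists>j<n. i = m + 1 + j)"
    using x by (auto simp: odd_even_degrees_def image_iff; presburger)
  also have "\<dots> \<longleftrightarrow> m + 1 \<le> i \<and> i \<le> m + n" by presburger
  finally show ?thesis using x by auto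
qed

lemma length_Lambda:
  assumes "n \<ge> 1"
  shows "length (Lambda k m n) = 2 * n + k"
  using assms by (auto simp: Lambda_def)

text \<open>One inclusion suffices, since both lists are distinct and have length
  \<open>2 * n + k\<close>.\<close>

lemma set_degree_vector_Lambda:
  assumes "n \<ge> 1"
  shows "set (degree_vector (Lambda k m n)) = set (odd_even_degrees k m n)"
proof -
  let ?L = "Lambda k m n"
  have "degree_vector ?L ! j \<in> set (odd_even_degrees k m n)" if j: "j < 2 * n + k" for j
  proof -
    have dv: "degree_vector ?L ! j = ?L ! j + (2 * n + k - (j + 1))"
      using j by (simp add: nth_degree_vector length_Lambda[OF assms])
    consider (1) "n + k < m + 2" | (2) "m + 2 \<le> n + k" "k < m + 1" | (3) "m + 1 \<le> k" by linarith
    then show ?thesis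
    proof cases
      case 1
      then have "?L = map (\<lambda>j. 2 * m + 1 - j - k) [0..<n] @ map (\<lambda>j. n + k - j) [0..<n + k]"
        by (simp add: Lambda_def)
      then have "?L ! j = (if j < n then 2 * m + 1 - j - k else n + k - (j - n))"
        using j by (simp add: nth_append)
      then have "degree_vector ?L ! j = (if j < n then 2 * (m + n - j) else 2 * (2 * n + k - j) - 1)"
        using 1 j unfolding dv by auto
      then show ?thesis using 1 j unfolding in_odd_even_degrees_iff by auto
    next
      case 2
      \<comment> \<open>The degrees are even down to \<open>2 (n + k)\<close>, then consecutive from
        \<open>2 (n + k) - 1\<close> to \<open>2 m + 2\<close>, then odd.\<close>
      then have "?L = map (\<lambda>j. 2 * m + 1 - j - k) [0..<m - k + 1]
         @ replicate (2 * (n + k - m - 1)) (m + 1) @ map (\<lambda>j. m + 1 - j) [0..<m + 1]"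
        by (simp add: Lambda_def del: upt_Suc)
      then have "?L ! j = (if j < m - k + 1 then 2 * m + 1 - j - k
          else if j < 2 * n + k - m - 1 then m + 1 else m + 1 - (j - (2 * n + k - m - 1)))"
        using j 2 by (auto simp: nth_append simp del: upt_Suc)
      then have "degree_vector ?L ! j = (if j < m - k + 1 then 2 * (m + n - j)
          else if j < 2 * n + k - m - 1 then 2 * n + k + m - j else 2 * (2 * n + k - j) - 1)"
        using 2 j unfolding dv by auto
      then show ?thesis using 2 j unfolding in_odd_even_degrees_iff by auto
    next
      case 3
      \<comment> \<open>The degrees start with odd ones above \<open>2 (m + n)\<close>. The
        \<open>2 * n - 1\<close> equal parts give the consecutive degrees from
        \<open>2 (m + n)\<close> to \<open>2 m + 2\<close>, and odd degrees follow.\<close>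
      then have "?L = map (\<lambda>j. k - j) [0..<k - m]
         @ replicate (2 * n - 1) (m + 1) @ map (\<lambda>j. m + 1 - j) [0..<m + 1]"
        using assms by (simp add: Lambda_def del: upt_Suc)
      then have "?L ! j = (if j < k - m then k - j
          else if j < 2 * n + k - m - 1 then m + 1 else m + 1 - (j - (2 * n + k - m - 1)))"
        using j 3 assms by (auto simp: nth_append simp del: upt_Suc)
      then have "degree_vector ?L ! j = (if j < k - m then 2 * (n + k - j) - 1
          else if j < 2 * n + k - m - 1 then 2 * n + k + m - j else 2 * (2 * n + k - j) - 1)"
        using 3 j unfolding dv by auto
      then show ?thesis using 3 j unfolding in_odd_even_degrees_iff by auto
    qed
  qed
  then have "set (degree_vector ?L) \<subseteq> set (odd_even_degrees k m n)"
    by (auto simp: in_set_conv_nth[of _ "degree_vector ?L"] length_Lambda[OF assms])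
  moreover have "distinct (degree_vector ?L)"
    using is_partition_Lambda by (intro distinct_degree_vector) (simp add: is_partition_def)
  ultimately show ?thesis
    by (intro card_subset_eq) (simp_all add: distinct_card distinct_odd_even_degrees length_Lambda[OF assms])
qed

lemma double_sum_lessThan: "2 * (\<Sum>i<n. i) + n = n * (n :: nat)"
  by (induction n) simp_all

text \<open>The excess over the triangular number is the size of the partition
  \<open>Lambda k m n\<close> for \<open>n \<ge> 1\<close>; it becomes the exponent of
  \<open>- \<i>\<close> under conjugation.\<close>

lemma sum_list_odd_even_degrees:
  "sum_list (odd_even_degrees k m n) = k * (k + 1) div 2 + 2 * n * (m + 1) + (\<Sum>i<2 * n + k. i)"
proof -
  have "sum_list (odd_even_degrees k m n) = (\<Sum>j<n + k. 1 + 2 * j) + (\<Sum>j<n. 2 * (m + 1 + j))"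
    by (simp add: odd_even_degrees_def interv_sum_list_conv_sum_set_nat atLeast0LessThan)
  also have "\<dots> = ((n + k) + 2 * (\<Sum>j<n + k. j)) + (2 * n * (m + 1) + 2 * (\<Sum>j<n. j))"
  proof -
    have "(\<Sum>j<N. 1 + 2 * j) = N + 2 * (\<Sum>j<N. j)" for N :: nat by (induction N) auto
    moreover have "(\<Sum>j<n. 2 * (m + 1 + j)) = 2 * n * (m + 1) + 2 * (\<Sum>j<n. j)"
      by (induction n) (auto simp: algebra_simps)
    ultimately show ?thesis by presburger
  qed
  finally have "2 * sum_list (odd_even_degrees k m n) + 2 * n
      = 2 * ((n + k) * (n + k)) + 4 * n * (m + 1) + 2 * (n * n)"
    using double_sum_lessThan[of "n + k"] double_sum_lessThan[of n] by simp
  moreover have "2 * (k * (k + 1) div 2) = k * k + k" by simp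
  moreover have "2 * (\<Sum>i<2 * n + k. i) + (2 * n + k) = 4 * (n * n) + 4 * (n * k) + k * k"
    unfolding double_sum_lessThan by (simp add: algebra_simps)
  ultimately show ?thesis by (simp add: algebra_simps)
qed

section \<open>The main identity\<close>

lemma vandermonde_snoc:
  "vandermonde (xs @ [y]) = vandermonde xs * (\<Prod>j<length xs. of_nat y - of_nat (xs ! j))"
  by (simp add: vandermonde_def nth_append)

lemma vandermonde_append:
  "vandermonde (xs @ ys)
    = vandermonde xs * (\<Prod>k<length ys. \<Prod>j<length xs. of_nat (ys ! k) - of_nat (xs ! j)) * vandermonde ys"
proof (induction ys rule: rev_induct)
  case (snoc y ys)
  have "(\<Prod>j<length xs + length ys. of_nat y - of_nat ((xs @ ys) ! j))
    = (\<Prod>j<length xs. of_nat y - of_nat (xs ! j)) * (\<Prod>j<length ys. of_nat y - of_nat (ys ! j) :: complex)"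
  proof -
    have "(\<Prod>j<a + b. f j) = (\<Prod>j<a. f j) * (\<Prod>j<b. f (a + j))" for a b and f :: "nat \<Rightarrow> complex"
      by (induction b) (simp_all add: mult_ac)
    then show ?thesis by (simp add: nth_append)
  qed
  then show ?case
    using vandermonde_snoc[of "xs @ ys" y] vandermonde_snoc[of ys y] snoc
    by (simp add: nth_append mult_ac)
qed (simp add: vandermonde_def)

lemma vandermonde_arithmetic: "vandermonde (map (\<lambda>j. a + 2 * j) [0..<n]) = (\<Prod>k<n. 2 ^ k * fact k)"
proof -
  have "(\<Prod>j<k. of_nat (a + 2 * k) - of_nat (a + 2 * j)) = (2 ^ k * fact k :: complex)" for k
  proof -
    have "(\<Prod>j<k. of_nat (a + 2 * k) - of_nat (a + 2 * j)) = odd_factor k (2 * k + 1)"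
      unfolding odd_factor_def by (intro prod.cong) (simp_all add: algebra_simps)
    then show ?thesis by (simp only: odd_factor_odd_self)
  qed
  then show ?thesis by (auto simp: vandermonde_def intro!: prod.cong)
qed

text \<open>The differences between even and odd degrees are the same \<open>odd_factor\<close>
  values that arise from the even Hermite polynomials, so they cancel in
  \<open>b_const\<close>.\<close>

lemma vandermonde_odd_even_degrees:
  "vandermonde (odd_even_degrees k m n)
    = (\<Prod>i<n + k. 2 ^ i * fact i) * (\<Prod>j<n. odd_factor (n + k) (2 * (m + 1 + j))) * (\<Prod>j<n. 2 ^ j * fact j)"
proof -
  have ev: "map (\<lambda>j. 2 * (m + 1 + j)) [0..<n] = map (\<lambda>j. 2 * (m + 1) + 2 * j) [0..<n]" by simp
  have "(\<Prod>i<length (map (\<lambda>j. 2 * (m + 1 + j)) [0..<n]). \<Prod>j<length (map (\<lambda>j. 1 + 2 * j) [0..<n + k]).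
      of_nat (map (\<lambda>j. 2 * (m + 1 + j)) [0..<n] ! i) - of_nat (map (\<lambda>j. 1 + 2 * j) [0..<n + k] ! j))
    = (\<Prod>i<n. odd_factor (n + k) (2 * (m + 1 + i)))"
    by (auto simp: odd_factor_def add.commute intro!: prod.cong)
  then show ?thesis
    unfolding odd_even_degrees_def vandermonde_append vandermonde_arithmetic
    unfolding ev vandermonde_arithmetic by simp
qed

lemma vandermonde_nonzero: "distinct hs \<Longrightarrow> vandermonde hs \<noteq> 0"
  by (auto simp: vandermonde_def nth_eq_iff_index_eq)

lemma c_const_eq: "c_const m n = (- 1) ^ (n * (m + 1) + (\<Sum>i<n. i)) * (\<Prod>j<n. fact j / fact (m + 1 + j))"
proof -
  have "n * (2 * m + 1 + n) = 2 * (n * (m + 1) + (\<Sum>i<n. i))"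
    using double_sum_lessThan[of n] by (simp add: algebra_simps)
  then have "n * (2 * m + 1 + n) div 2 = n * (m + 1) + (\<Sum>i<n. i)" by simp
  moreover have "(\<Prod>j = 1..n. fact (j - 1) / fact (m + j)) = (\<Prod>j<n. fact j / fact (m + 1 + j) :: complex)"
    by (rule prod.reindex_bij_witness[of _ Suc "\<lambda>j. j - 1"]) auto
  ultimately show ?thesis by (simp add: c_const_def)
qed

text \<open>With \<open>z ^ K\<close> on the right both sides are polynomial in \<open>z\<close>, so
  the identity includes \<open>z = 0\<close>.\<close>

lemma T_poly_wronskian:
  fixes m n k :: nat and z :: complex
  defines "K \<equiv> k * (k + 1) div 2"
  shows "b_const k m n * poly (wronskian (map hermite (odd_even_degrees k m n))) z
    = z ^ K * poly (T_poly m n (- 2 * of_nat n - of_nat k - 1 / 2)) (z\<^sup>2 / 2)"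
proof -
  let ?r = "n + k" and ?s = "\<lambda>n :: nat. \<Sum>i<n. i"
  let ?T = "T_poly m n (- 2 * of_nat n - of_nat k - 1 / 2)"
  let ?W = "wronskian (map hermite (odd_even_degrees k m n))"
  define P where "P = (\<Prod>i<?r. 2 ^ i * fact i :: complex)"
  define Q where "Q = (\<Prod>j<n. odd_factor ?r (2 * (m + 1 + j)))"
  define F where "F = (\<Prod>j<n. fact (m + 1 + j) :: complex)"
  define G where "G = (\<Prod>j<n. fact j :: complex)"
  define e where "e = n * (m + 1) + ?s n"
  \<comment> \<open>The power \<open>?s (?r + n)\<close> comes from the Euler form of the Wronskian,
    \<open>?r * ?r\<close> from the odd block, and \<open>2 * ?s n\<close> from \<open>u\<close>;
    the balance is \<open>K\<close>.\<close>
  have exps: "?s (?r + n) + K = ?r * ?r + 2 * ?s n"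
  proof -
    have "2 * K = k * k + k" by (simp add: K_def)
    then show ?thesis
      using double_sum_lessThan[of "?r + n"] double_sum_lessThan[of n] by (simp add: algebra_simps)
  qed
  have T: "poly ?T u = poly (wronskian (map (\<lambda>j. laguerre (m + 1 + j) (- 1 / 2 - of_nat ?r)) [0..<n])) u" for u
  proof -
    have "- 2 * of_nat n - of_nat k - 1 / 2 = (- 1 / 2 - of_nat ?r) - (of_nat n :: complex)" by simp
    then show ?thesis by (simp only: poly_T_poly)
  qed
  have W: "map hermite (odd_even_degrees k m n) = map (\<lambda>j. hermite (1 + 2 * j)) [0..<?r]
            @ map (\<lambda>j. hermite (2 * (m + 1 + j))) [0..<n]"
    by (simp add: odd_even_degrees_def del: hermite.simps)
  have nonzero: "poly ?W x = P * (- 2) ^ e * F * Q * x ^ K * poly ?T (x\<^sup>2 / 2)" if "x \<noteq> 0" for x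
  proof -
    have "(\<Prod>k<?r. x ^ (2 * k + 1)) = x ^ (?r * ?r)"
    proof -
      have "(\<Sum>k<N. 2 * k + 1) = N * N" for N :: nat by (induction N) auto
      then show ?thesis by (simp only: power_sum[symmetric])
    qed
    then have p1: "(\<Prod>k<?r. 2 ^ k * fact k * x ^ (2 * k + 1)) = P * x ^ (?r * ?r)"
      by (simp only: P_def prod.distrib)
    have "(\<Prod>j<n. (- 2) ^ (m + 1 + j) :: complex) = (- 2) ^ e"
    proof -
      have "(\<Sum>j<N. m + 1 + j) = N * (m + 1) + ?s N" for N by (induction N) auto
      then show ?thesis by (simp only: power_sum[symmetric] e_def)
    qed
    then have p2: "(\<Prod>j<n. (- 2) ^ (m + 1 + j) * fact (m + 1 + j) * odd_factor ?r (2 * (m + 1 + j))) = (- 2) ^ e * F * Q"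
      by (simp only: F_def Q_def prod.distrib)
    have p3: "(\<Prod>i<n. 2 ^ i) * (x\<^sup>2 / 2) ^ ?s n = x ^ (2 * ?s n)"
      by (simp add: power_divide power_mult flip: power_sum)
    have "x ^ ?s (?r + n) * poly ?W x = P * x ^ (?r * ?r) * ((\<Prod>i<n. 2 ^ i) * ((- 2) ^ e * F * Q)
       * ((x\<^sup>2 / 2) ^ ?s n * poly ?T (x\<^sup>2 / 2)))"
      using wronskian_odd_even_hermite[of x ?r n m] unfolding p1 p2 T[symmetric] W[symmetric] .
    also have "\<dots> = P * (- 2) ^ e * F * Q * (x ^ (?r * ?r) * ((\<Prod>i<n. 2 ^ i) * (x\<^sup>2 / 2) ^ ?s n)) * poly ?T (x\<^sup>2 / 2)"
      by (simp only: mult_ac)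
    also have "x ^ (?r * ?r) * ((\<Prod>i<n. 2 ^ i) * (x\<^sup>2 / 2) ^ ?s n) = x ^ ?s (?r + n) * x ^ K"
      unfolding p3 by (simp only: power_add[symmetric] exps)
    finally have "x ^ ?s (?r + n) * poly ?W x = x ^ ?s (?r + n) * (P * (- 2) ^ e * F * Q * x ^ K * poly ?T (x\<^sup>2 / 2))"
      by (simp only: mult_ac)
    then show ?thesis using that by simp
  qed
  \<comment> \<open>Cancelling a power of \<open>x\<close> required \<open>x \<noteq> 0\<close>; a
    polynomial that vanishes off the origin is zero, which adds the missing point.\<close>
  define R where "R = ?W - smult (P * (- 2) ^ e * F * Q) (monom 1 K * pcompose ?T [:0, 0, 1 / 2:])"
  have Rx: "poly R x = poly ?W x - P * (- 2) ^ e * F * Q * x ^ K * poly ?T (x\<^sup>2 / 2)" for x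
    by (simp add: R_def poly_pcompose poly_monom power2_eq_square)
  have "- {0} \<subseteq> {x. poly R x = 0}" using nonzero Rx by auto
  moreover have "infinite (- {0 :: complex})"
    using infinite_UNIV_char_0[where 'a = complex] by (simp add: Compl_eq_Diff_UNIV)
  ultimately have "R = 0" using poly_roots_finite finite_subset by blast
  then have main: "poly ?W z = P * (- 2) ^ e * F * Q * z ^ K * poly ?T (z\<^sup>2 / 2)"
    using Rx[of z] by simp
  have c: "c_const m n = (- 1) ^ e * G / F"
    by (simp add: c_const_eq e_def F_def G_def prod_dividef)
  have V: "vandermonde (odd_even_degrees k m n) = P * Q * (2 ^ ?s n * G)"
    unfolding vandermonde_odd_even_degrees by (simp add: P_def Q_def G_def prod.distrib power_sum)
  have b: "b_const k m n = c_const m n / (2 ^ (n * (m + 1)) * vandermonde (odd_even_degrees k m n))"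
    by (simp add: b_const_def odd_even_degrees_def power_int_minus power_int_of_nat field_simps del: of_nat_mult of_nat_Suc of_nat_add)
  have FG: "F \<noteq> 0" "G \<noteq> 0" by (simp_all add: F_def G_def del: fact_Suc)
  have PQ: "P \<noteq> 0" "Q \<noteq> 0"
    using vandermonde_nonzero[OF distinct_odd_even_degrees, of k m n] unfolding V by auto
  \<comment> \<open>The sign cancels the one in \<open>c_const\<close>; the power of 2 splits into
    the explicit power in \<open>b_const\<close> and the one in the Vandermonde product.\<close>
  have "(- 2 :: complex) ^ e = (- 1) ^ e * 2 ^ e" by (rule power_minus)
  moreover have "(2 :: complex) ^ e = 2 ^ (n * (m + 1)) * 2 ^ ?s n" by (simp only: e_def power_add)
  moreover have "(- 1 :: complex) ^ e * (- 1) ^ e = 1" by (simp flip: power_mult_distrib)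
  ultimately have "b_const k m n * (P * (- 2) ^ e * F * Q) = 1"
    unfolding b c V using FG PQ by (simp add: field_simps)
  then show ?thesis unfolding main by (simp add: mult.assoc[symmetric])
qed

text \<open>For \<open>k > 0\<close> the negative power of \<open>z\<close> takes the default value
  0 at the origin, so the formulas are claimed there only for \<open>k = 0\<close>.\<close>

theorem lemma7p6:
  fixes m n k :: nat and z :: complex
  assumes "n \<ge> 1" and "z \<noteq> 0 \<or> k = 0"
  shows
    "poly (T_poly m n (- 2 * of_nat n - of_nat k - 1 / 2)) (z\<^sup>2 / 2)
       = 2 powi (- int (n * (m + 1))) * c_const m n * z powi (- int (k * (k + 1) div 2))
         * poly (wronskian_hermite (Lambda k m n)) z
     \<and>
     poly (T_poly m n (- 2 * of_nat n - of_nat k - 1 / 2)) (z\<^sup>2 / 2)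
       = b_const k m n * z powi (- int (k * (k + 1) div 2))
         * poly (wronskian (map (\<lambda>j. hermite (1 + 2 * j)) [0..<n + k]
                            @ map (\<lambda>j. hermite (2 * (m + 1 + j))) [0..<n])) z
     \<and>
     poly (T_poly m n (- 2 * of_nat n - of_nat k - 1 / 2)) (- (z\<^sup>2 / 2))
       = (- 1) ^ (n * (m + 1)) * 2 powi (- int (n * (m + 1))) * c_const m n
         * z powi (- int (k * (k + 1) div 2))
         * poly (wronskian_hermite (conjugate_partition (Lambda k m n))) z"
proof -
  let ?T = "T_poly m n (- 2 * of_nat n - of_nat k - 1 / 2)"
  define K where "K = k * (k + 1) div 2"
  define M where "M = n * (m + 1)"
  let ?ps = "Lambda k m n" and ?hs = "odd_even_degrees k m n"
  have sorted: "sorted_wrt (\<ge>) ?ps" using is_partition_Lambda by (simp add: is_partition_def)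
  have len: "length ?ps = 2 * n + k" by (rule length_Lambda[OF assms(1)])
  have ne: "?ps \<noteq> []" using len assms(1) by auto
  have WH: "poly (wronskian_hermite ps) x = hermite_quotient (degree_vector ps) x" for ps x
    by (simp add: wronskian_hermite_def hermite_quotient_def)
  have perm: "hermite_quotient (degree_vector ?ps) x = hermite_quotient ?hs x" for x
    by (intro hermite_quotient_permute distinct_degree_vector sorted distinct_odd_even_degrees
        set_degree_vector_Lambda assms(1))
  have second: "poly ?T (x\<^sup>2 / 2) = b_const k m n * x powi (- int K) * poly (wronskian (map hermite ?hs)) x"
    if "x \<noteq> 0 \<or> k = 0" for x
  proof -
    have "x ^ K \<noteq> 0" using that by (auto simp: K_def)
    then have "poly ?T (x\<^sup>2 / 2) = x ^ K * poly ?T (x\<^sup>2 / 2) / x ^ K" by simp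
    also have "\<dots> = b_const k m n * poly (wronskian (map hermite ?hs)) x / x ^ K"
      unfolding K_def T_poly_wronskian[symmetric] ..
    finally show ?thesis by (simp add: power_int_minus field_simps)
  qed
  have first: "poly ?T (x\<^sup>2 / 2) = 2 powi (- int M) * c_const m n * x powi (- int K) * hermite_quotient ?hs x"
    if "x \<noteq> 0 \<or> k = 0" for x
    unfolding second[OF that]
    by (simp add: hermite_quotient_def b_const_def odd_even_degrees_def M_def mult_ac del: of_nat_mult of_nat_add of_nat_Suc hermite.simps)
  \<comment> \<open>The exponent \<open>K + 2 * M\<close> is the size of
    \<open>Lambda k m n\<close>, left after the triangular number is cancelled.\<close>
  have conj: "hermite_quotient (degree_vector (conjugate_partition ?ps)) z
      = (- \<i>) ^ (K + 2 * M) * hermite_quotient ?hs (\<i> * z)"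
  proof -
    have "sum_list (degree_vector ?ps) = sum_list ?hs"
      using sum_list_distinct_conv_sum_set[OF distinct_degree_vector[OF sorted], of "\<lambda>x. x"]
        sum_list_distinct_conv_sum_set[OF distinct_odd_even_degrees, of "\<lambda>x. x" k m n]
      by (simp add: set_degree_vector_Lambda[OF assms(1)])
    also have "\<dots> = (K + 2 * M) + (\<Sum>i<2 * n + k. i)"
      unfolding sum_list_odd_even_degrees by (simp add: K_def M_def)
    finally have sum: "sum_list (degree_vector ?ps) = (K + 2 * M) + (\<Sum>i<2 * n + k. i)" .
    have "(- \<i>) ^ (\<Sum>i<2 * n + k. i) * hermite_quotient (degree_vector (conjugate_partition ?ps)) z
       = (- \<i>) ^ (\<Sum>i<2 * n + k. i) * ((- \<i>) ^ (K + 2 * M) * hermite_quotient ?hs (\<i> * z))"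
      using hermite_quotient_complement[OF degree_vector_conjugate[OF sorted ne], of z]
      unfolding sum perm length_degree_vector len power_add by (simp only: mult_ac)
    then show ?thesis by simp
  qed
  \<comment> \<open>Replacing \<open>z\<close> by \<open>\<i> * z\<close> negates the argument of
    \<open>?T\<close>.\<close>
  have "poly ?T (- (z\<^sup>2 / 2)) = 2 powi (- int M) * c_const m n * (\<i> * z) powi (- int K) * hermite_quotient ?hs (\<i> * z)"
    using first[of "\<i> * z"] assms(2) by (simp add: power_mult_distrib)
  also have "(\<i> * z) powi (- int K) = z powi (- int K) * (- \<i>) ^ K"
    by (simp add: power_int_minus power_mult_distrib power_inverse[symmetric] mult.commute)
  \<comment> \<open>Raising the exponent to the one in \<open>conj\<close> costs the sign
    \<open>(- \<i>) ^ (2 * M) = (- 1) ^ M\<close>, which is the sign in the last formula.\<close>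
  also have "(- \<i>) ^ K = (- 1) ^ M * (- \<i>) ^ (K + 2 * M)"
    by (simp add: power_add power_mult flip: power_mult_distrib)
  finally have third: "poly ?T (- (z\<^sup>2 / 2)) = (- 1) ^ M * 2 powi (- int M) * c_const m n * z powi (- int K)
      * hermite_quotient (degree_vector (conjugate_partition ?ps)) z"
    unfolding conj by (simp only: mult_ac)
  have W: "map hermite ?hs = map (\<lambda>j. hermite (1 + 2 * j)) [0..<n + k]
            @ map (\<lambda>j. hermite (2 * (m + 1 + j))) [0..<n]"
    by (simp add: odd_even_degrees_def del: hermite.simps)
  show ?thesis
    using first[OF assms(2)] second[OF assms(2)] third
    unfolding WH perm W K_def M_def by blast
qed

end
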